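(* Let $\mathbb{K}$ be a field, $V$ a $3$-dimensional $\mathbb{K}$-vector space, $\mathrm{P}=\mathrm{P}(V)$ its projective plane, and $\Delta=(p_1,p_2,p_3)$ a triangle in $\mathrm{P}$ (three non-collinear points). Then for every generic point $p\in\mathrm{P}$ (i.e. $p$ lies on none of the sides of $\Delta$), the polar lines of $p$ with respect to $\Delta$ satisfy $$p^\bullet=p^\#=p^\perp=p^\circ$$ whenever $\mathbb{K}$ allows the terms involved to be defined. That is: $p^\bullet=p^\#$ over any field $\mathbb{K}$; $p^\perp=p^\bullet$ if the characteristic of $\mathbb{K}$ is different from $2$ and $3$; and $p^\circ=p^\bullet$ if $\mathbb{K}=\mathbb{R}$. Here $p^\bullet$ is the frame polar, $p^\#$ the harmonic polar, $p^\perp$ the (second) cubic polar and $p^\circ$ the convex polar of $p$ with respect to $\Delta$.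
   Context: Notation. $\mathrm{P}(V)$ is the set of vector lines of $V$; $\mathrm{P}(\vec v)$ is the line spanned by $\vec v\neq 0$. The sides of $\Delta$ are the lines $D_1=(p_2p_3)$, $D_2=(p_1p_3)$, $D_3=(p_1p_2)$. Duality. $\mathrm{P}^*=\mathrm{P}(V^* )$. For a point $a\in\mathrm{P}$, $a^*\subset\mathrm{P}^*$ is the line consisting of the classes of nonzero linear forms vanishing on $a$. For a line $A\subset\mathrm{P}$, $A^*\in\mathrm{P}^*$ is the class of a nonzero linear form whose kernel projectivizes to $A$. Identifying $V$ with $V^{**}$ canonically, the same notation is used from $\mathrm{P}^*$ to $\mathrm{P}$, and $a^{**}=a$, $A^{**}=A$. Frames. A (projective) frame of $\mathrm{P}(V)$, $\dim V=3$, is a quadruple $(r_1,r_2,r_3,r_+)$ of points, no three of which are collinear. There is a basis $(\vec b_1,\vec b_2,\vec b_3)$ of $V$, unique up to a common scalar and called adapted to the frame, with $r_i=\mathrm{P}(\vec b_i)$ and $r_+=\mathrm{P}(\vec b_1+\vec b_2+\vec b_3)$. The dual frame is the frame of $\mathrm{P}(V^* )$ given by $(\mathrm{P}(\vec b_1^* ),\mathrm{P}(\vec b_2^* ),\mathrm{P}(\vec b_3^* ),\mathrm{P}(\vec b_1^*+\vec b_2^*+\vec b_3^* ))$, where $(\vec b_i^* )$ is the dual basis of an adapted basis; it does not depend on the choice of adapted basis. Frame polar $p^\bullet$. For $p$ generic, $(p_1,p_2,p_3,p)$ is a frame. Let $(q_1,q_2,q_3,q)$ be its dual frame. Then $p^\bullet:=q^*$,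 a line of $\mathrm{P}$. Harmonic polar $p^\#$. On a projective line, the fourth harmonic of a triple $(a,b,c)$ of distinct points is the point $d$ such that the cross-ratio of $(a,b,c,d)$ is $-1$, i.e. in homogeneous coordinates with $a=[1:0]$, $b=[0:1]$, $c=[1:1]$ one has $d=[-1:1]$. For each permutation $(i,j,k)$ of $(1,2,3)$ let $u_i=(p_ip)\cap(p_jp_k)$ and let $u_i'$ be the fourth harmonic of $(p_j,p_k,u_i)$. The points $u_1',u_2',u_3'$ are collinear, and $p^\#$ is the line they span. Cubic polar $p^\perp$ (characteristic of $\mathbb{K}$ different from $2,3$). Let $C=\ell_1\ell_2\ell_3$, where $\ell_i\in V^*$ is a nonzero linear form whose kernel projectivizes to $D_i$; $C$ is a cubic form on $V$ defined up to a nonzero scalar. Let $\psi:V\times V\times V\to\mathbb{K}$ be its polar form, the unique symmetric trilinear form with $\psi(\vec u,\vec u,\vec u)=C(\vec u)$ for all $\vec u\in V$. For $p=\mathrm{P}(\vec u)$ generic, the linear form $\psi(\vec u,\vec u,\cdot)$ is nonzero, and $p^\perp$ is the line $\{\mathrm{P}(\vec v)\,:\,\psi(\vec u,\vec u,\vec v)=0\}$. Convex polar $p^\circ$ ($\mathbb{K}=\mathbb{R}$). A subset of a real projective plane is convex if its intersection with every projective line is connected; it is proper if some projective line misses its closure. An affine chart sends a line $D$ to infinity if it is an identification of the complement of $D$ with the affine plane. If $C$ is a nonempty proper open convex set and $D$ is a line not meeting $\overline{C}$, then $D^\circ$ (with respect to $C$) is the barycenter (center of gravity) of $C$ in any affine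 chart sending $D$ to infinity; this does not depend on the chart. The dual convex set $C^*\subset\mathrm{P}^*$ is the set of (points dual to) lines of $\mathrm{P}$ not meeting $\overline{C}$; it is a proper open convex set. For $x\in C$, the line $x^*\subset\mathrm{P}^*$ does not meet $\overline{C^*}$, and the convex polar of $x$ with respect to $C$ is the line of $\mathrm{P}$ dual to the point $(x^* )^\circ\in\mathrm{P}^*$, the latter computed with respect to $C^*$. For $p$ generic, $p^\circ$ is the convex polar of $p$ with respect to the connected component of $\mathrm{P}\setminus(D_1\cup D_2\cup D_3)$ containing $p$ (each such component is a proper open convex set). *)

theory Defs
  imports "HOL-Analysis.Analysis" "HOL-Library.Function_Algebras"
begin

text \<open>
  Projective geometry is developed relative to a linear subspace \<open>W\<close> of the ambient vector
  space. This makes it possible to use the same definitions for \<open>P(V)\<close>, where \<open>W = UNIV\<close>, and for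
  \<open>P(V*)\<close>, where \<open>W\<close> is the space of linear forms inside the space of all functions on \<open>V\<close>.
  A point is a vector line (a set of vectors); a projective line is a set of points.
\<close>

locale proj_space = vector_space scale
  for scale :: "'a::field \<Rightarrow> 'b::ab_group_add \<Rightarrow> 'b"
begin

definition pt :: "'b \<Rightarrow> 'b set" where
  "pt v = span {v}"

definition Proj :: "'b set \<Rightarrow> 'b set set" where
  "Proj W = {pt v | v. v \<in> W \<and> v \<noteq> 0}"

definition proj_line :: "'b set \<Rightarrow> 'b set set \<Rightarrow> bool" where
  "proj_line W L \<longleftrightarrow> (\<exists>S. subspace S \<and> S \<subseteq> W \<and> dim S = 2 \<and> L = Proj S)"

definition proj_join :: "'b set \<Rightarrow> 'b set \<Rightarrow> 'b set set" where
  "proj_join a b = Proj (span (a \<union> b))"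

definition is_basis3 :: "'b set \<Rightarrow> 'b \<Rightarrow> 'b \<Rightarrow> 'b \<Rightarrow> bool" where
  "is_basis3 W b1 b2 b3 \<longleftrightarrow>
     distinct [b1, b2, b3] \<and> independent {b1, b2, b3} \<and> span {b1, b2, b3} = W"

definition triangle :: "'b set \<Rightarrow> 'b set \<Rightarrow> 'b set \<Rightarrow> bool" where
  "triangle p1 p2 p3 \<longleftrightarrow>
     p1 \<in> Proj UNIV \<and> p2 \<in> Proj UNIV \<and> p3 \<in> Proj UNIV \<and>
     \<not> (\<exists>L. proj_line UNIV L \<and> p1 \<in> L \<and> p2 \<in> L \<and> p3 \<in> L)"

definition generic :: "'b set \<Rightarrow> 'b set \<Rightarrow> 'b set \<Rightarrow> 'b set \<Rightarrow> bool" where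
  "generic p1 p2 p3 p \<longleftrightarrow>
     p \<in> Proj UNIV \<and> p \<notin> proj_join p2 p3 \<and> p \<notin> proj_join p1 p3 \<and> p \<notin> proj_join p1 p2"

text \<open>A quadruple of points of \<open>P(W)\<close> is a projective frame iff it has an adapted basis, which is
  then unique up to a common scalar.\<close>

definition adapted_basis ::
  "'b set \<Rightarrow> 'b set \<times> 'b set \<times> 'b set \<times> 'b set \<Rightarrow> 'b \<Rightarrow> 'b \<Rightarrow> 'b \<Rightarrow> bool" where
  "adapted_basis W R b1 b2 b3 \<longleftrightarrow>
     is_basis3 W b1 b2 b3 \<and> R = (pt b1, pt b2, pt b3, pt (b1 + b2 + b3))"

text \<open>The point \<open>d\<close> of the line \<open>(ab)\<close> with coordinates \<open>[-1 : 1]\<close> when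
  \<open>a = [1 : 0]\<close>, \<open>b = [0 : 1]\<close> and \<open>c = [1 : 1]\<close>.\<close>

definition fourth_harmonic :: "'b set \<Rightarrow> 'b set \<Rightarrow> 'b set \<Rightarrow> 'b set" where
  "fourth_harmonic a b c =
     (THE d. \<exists>x y. x \<noteq> y \<and> independent {x, y} \<and>
        a = pt x \<and> b = pt y \<and> c = pt (x + y) \<and> d = pt (- x + y))"

definition meet_point :: "'b set set \<Rightarrow> 'b set set \<Rightarrow> 'b set" where
  "meet_point L M = (THE u. L \<inter> M = {u})"

text \<open>Since the notion of fourth harmonic is symmetric in its first two arguments, the point \<open>u'\<^sub>i\<close>
  depends on \<open>i\<close> only, and the three cyclic permutations suffice.
  If the three points were not collinear, the span below would be the whole plane.\<close>

definition harmonic_polar ::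
  "'b set \<Rightarrow> 'b set \<Rightarrow> 'b set \<Rightarrow> 'b set \<Rightarrow> 'b set set" where
  "harmonic_polar p1 p2 p3 p =
     (let u1 = meet_point (proj_join p1 p) (proj_join p2 p3);
          u2 = meet_point (proj_join p2 p) (proj_join p3 p1);
          u3 = meet_point (proj_join p3 p) (proj_join p1 p2)
      in Proj (span (fourth_harmonic p2 p3 u1 \<union> fourth_harmonic p3 p1 u2 \<union> fourth_harmonic p1 p2 u3)))"

end

text \<open>Linear forms live in the space of all functions, with the pointwise vector space structure.\<close>

definition dual_scale :: "'a::field \<Rightarrow> ('b \<Rightarrow> 'a) \<Rightarrow> 'b \<Rightarrow> 'a" where
  "dual_scale c f = (\<lambda>x. c * f x)"

interpretation dual: proj_space dual_scale
  by unfold_locales (auto simp: dual_scale_def fun_eq_iff algebra_simps)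

context proj_space
begin

definition linear_form :: "('b \<Rightarrow> 'a) \<Rightarrow> bool" where
  "linear_form f \<longleftrightarrow> Vector_Spaces.linear scale (*) f"

definition dual_space :: "('b \<Rightarrow> 'a) set" where
  "dual_space = {f. linear_form f}"

definition kernel_line :: "('b \<Rightarrow> 'a) \<Rightarrow> 'b set set" where
  "kernel_line f = Proj {v. f v = 0}"

text \<open>Duality: \<open>a*\<close> for a point \<open>a\<close> of \<open>P(V)\<close>, \<open>A*\<close> for a line \<open>A\<close> of \<open>P(V)\<close>, and
  \<open>q*\<close> for a point \<open>q\<close> of \<open>P(V*)\<close>. The latter is a line of \<open>P(V)\<close>, after the canonical
  identification of a vector with the evaluation at this vector.\<close>

definition point_dual :: "'b set \<Rightarrow> ('b \<Rightarrow> 'a) set set" where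
  "point_dual a = dual.Proj {f \<in> dual_space. \<forall>v\<in>a. f v = 0}"

definition line_dual :: "'b set set \<Rightarrow> ('b \<Rightarrow> 'a) set" where
  "line_dual A = (THE q. \<exists>f. linear_form f \<and> f \<noteq> 0 \<and> kernel_line f = A \<and> q = dual.pt f)"

definition dual_point_dual :: "('b \<Rightarrow> 'a) set \<Rightarrow> 'b set set" where
  "dual_point_dual q = Proj {v. \<forall>f\<in>q. f v = 0}"

definition dual_basis3 ::
  "'b \<Rightarrow> 'b \<Rightarrow> 'b \<Rightarrow> ('b \<Rightarrow> 'a) \<Rightarrow> ('b \<Rightarrow> 'a) \<Rightarrow> ('b \<Rightarrow> 'a) \<Rightarrow> bool" where
  "dual_basis3 b1 b2 b3 f1 f2 f3 \<longleftrightarrow>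
     linear_form f1 \<and> linear_form f2 \<and> linear_form f3 \<and>
     f1 b1 = 1 \<and> f1 b2 = 0 \<and> f1 b3 = 0 \<and>
     f2 b1 = 0 \<and> f2 b2 = 1 \<and> f2 b3 = 0 \<and>
     f3 b1 = 0 \<and> f3 b2 = 0 \<and> f3 b3 = 1"

definition dual_frame ::
  "'b set \<times> 'b set \<times> 'b set \<times> 'b set \<Rightarrow>
     ('b \<Rightarrow> 'a) set \<times> ('b \<Rightarrow> 'a) set \<times> ('b \<Rightarrow> 'a) set \<times> ('b \<Rightarrow> 'a) set" where
  "dual_frame R =
     (THE Q. \<exists>b1 b2 b3 f1 f2 f3. adapted_basis UNIV R b1 b2 b3 \<and> dual_basis3 b1 b2 b3 f1 f2 f3 \<and>
        Q = (dual.pt f1, dual.pt f2, dual.pt f3, dual.pt (f1 + f2 + f3)))"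

definition frame_polar ::
  "'b set \<Rightarrow> 'b set \<Rightarrow> 'b set \<Rightarrow> 'b set \<Rightarrow> 'b set set" where
  "frame_polar p1 p2 p3 p =
     (case dual_frame (p1, p2, p3, p) of (q1, q2, q3, q) \<Rightarrow> dual_point_dual q)"

definition symmetric_trilinear :: "('b \<Rightarrow> 'b \<Rightarrow> 'b \<Rightarrow> 'a) \<Rightarrow> bool" where
  "symmetric_trilinear \<psi> \<longleftrightarrow>
     (\<forall>u v. linear_form (\<lambda>w. \<psi> u v w)) \<and>
     (\<forall>u w. linear_form (\<lambda>v. \<psi> u v w)) \<and>
     (\<forall>v w. linear_form (\<lambda>u. \<psi> u v w)) \<and>
     (\<forall>u v w. \<psi> u v w = \<psi> v u w \<and> \<psi> u v w = \<psi> u w v)"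

definition polar_form :: "('b \<Rightarrow> 'a) \<Rightarrow> 'b \<Rightarrow> 'b \<Rightarrow> 'b \<Rightarrow> 'a" where
  "polar_form C = (THE \<psi>. symmetric_trilinear \<psi> \<and> (\<forall>u. \<psi> u u u = C u))"

definition side_form :: "'b set \<Rightarrow> 'b set \<Rightarrow> ('b \<Rightarrow> 'a) \<Rightarrow> bool" where
  "side_form a b l \<longleftrightarrow> linear_form l \<and> l \<noteq> 0 \<and> kernel_line l = proj_join a b"

definition cubic_polar ::
  "'b set \<Rightarrow> 'b set \<Rightarrow> 'b set \<Rightarrow> 'b set \<Rightarrow> 'b set set" where
  "cubic_polar p1 p2 p3 p =
     (THE L. \<exists>l1 l2 l3 u. side_form p2 p3 l1 \<and> side_form p1 p3 l2 \<and> side_form p1 p2 l3 \<and>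
        u \<noteq> 0 \<and> p = pt u \<and>
        L = Proj {v. polar_form (\<lambda>x. l1 x * l2 x * l3 x) u u v = 0})"

end

definition center_of_gravity :: "(real^2) set \<Rightarrow> real^2" where
  "center_of_gravity S = (1 / measure lborel S) *\<^sub>R (LINT x:S|lborel. x)"

locale real_proj_space = proj_space scale
  for scale :: "real \<Rightarrow> 'b::ab_group_add \<Rightarrow> 'b"
begin

text \<open>For \<open>W\<close> of dimension 3: the quotient topology on \<open>P(W)\<close>, where \<open>W\<close> carries the
  topology of \<open>\<real>\<^sup>3\<close>. The latter does not depend on the basis used to identify \<open>W\<close> with \<open>\<real>\<^sup>3\<close>.\<close>

definition proj_open :: "'b set \<Rightarrow> 'b set set \<Rightarrow> bool" where
  "proj_open W U \<longleftrightarrow> U \<subseteq> Proj W \<and>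
     (\<forall>b1 b2 b3. is_basis3 W b1 b2 b3 \<longrightarrow>
        open {x :: real^3. x \<noteq> 0 \<and>
          pt (scale (x $ 1) b1 + scale (x $ 2) b2 + scale (x $ 3) b3) \<in> U})"

definition proj_topology :: "'b set \<Rightarrow> 'b set topology" where
  "proj_topology W = topology (proj_open W)"

lemma istopology_proj_open: "istopology (proj_open W)"
  unfolding istopology_def
proof (intro conjI allI impI)
  fix S T assume S: "proj_open W S" and T: "proj_open W T"
  show "proj_open W (S \<inter> T)"
    unfolding proj_open_def
  proof (intro conjI allI impI)
    show "S \<inter> T \<subseteq> Proj W" using S by (auto simp: proj_open_def)
    fix b1 b2 b3 assume b: "is_basis3 W b1 b2 b3"
    let ?g = "\<lambda>x :: real^3. pt (scale (x $ 1) b1 + scale (x $ 2) b2 + scale (x $ 3) b3)"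
    have "open ({x. x \<noteq> 0 \<and> ?g x \<in> S} \<inter> {x. x \<noteq> 0 \<and> ?g x \<in> T})"
      using S T b by (intro open_Int) (auto simp: proj_open_def)
    also have "{x. x \<noteq> 0 \<and> ?g x \<in> S} \<inter> {x. x \<noteq> 0 \<and> ?g x \<in> T} = {x. x \<noteq> 0 \<and> ?g x \<in> S \<inter> T}"
      by auto
    finally show "open {x. x \<noteq> 0 \<and> ?g x \<in> S \<inter> T}" .
  qed
next
  fix K assume K: "\<forall>S\<in>K. proj_open W S"
  show "proj_open W (\<Union>K)"
    unfolding proj_open_def
  proof (intro conjI allI impI)
    show "\<Union>K \<subseteq> Proj W" using K by (auto simp: proj_open_def)
    fix b1 b2 b3 assume b: "is_basis3 W b1 b2 b3"
    let ?g = "\<lambda>x :: real^3. pt (scale (x $ 1) b1 + scale (x $ 2) b2 + scale (x $ 3) b3)"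
    have "open (\<Union>S\<in>K. {x. x \<noteq> 0 \<and> ?g x \<in> S})"
      using K b by (intro open_UN) (auto simp: proj_open_def)
    also have "(\<Union>S\<in>K. {x. x \<noteq> 0 \<and> ?g x \<in> S}) = {x. x \<noteq> 0 \<and> ?g x \<in> \<Union>K}"
      by auto
    finally show "open {x. x \<noteq> 0 \<and> ?g x \<in> \<Union>K}" .
  qed
qed

lemma openin_proj_topology: "openin (proj_topology W) U \<longleftrightarrow> proj_open W U"
  by (simp add: proj_topology_def topology_inverse' istopology_proj_open)

definition proj_convex :: "'b set \<Rightarrow> 'b set set \<Rightarrow> bool" where
  "proj_convex W C \<longleftrightarrow> C \<subseteq> Proj W \<and>
     (\<forall>L. proj_line W L \<longrightarrow> connectedin (proj_topology W) (C \<inter> L))"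

definition avoiding_line :: "'b set \<Rightarrow> 'b set set \<Rightarrow> 'b set set \<Rightarrow> bool" where
  "avoiding_line W C L \<longleftrightarrow> proj_line W L \<and> L \<inter> (proj_topology W closure_of C) = {}"

definition proper_open_convex :: "'b set \<Rightarrow> 'b set set \<Rightarrow> bool" where
  "proper_open_convex W C \<longleftrightarrow>
     C \<noteq> {} \<and> openin (proj_topology W) C \<and> proj_convex W C \<and> (\<exists>L. avoiding_line W C L)"

text \<open>The map \<open>\<phi>\<close> is the inverse of an affine chart of \<open>P(W)\<close> sending the line \<open>D\<close> to infinity: it
  identifies the affine plane \<open>\<real>\<^sup>2\<close> with the complement of \<open>D\<close>.\<close>

definition affine_parametrization :: "'b set \<Rightarrow> 'b set set \<Rightarrow> (real^2 \<Rightarrow> 'b set) \<Rightarrow> bool" where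
  "affine_parametrization W D \<phi> \<longleftrightarrow>
     (\<exists>e1 e2 o'. is_basis3 W e1 e2 o' \<and> D = Proj (span {e1, e2}) \<and>
        \<phi> = (\<lambda>x. pt (scale (x $ 1) e1 + scale (x $ 2) e2 + o')))"

text \<open>The point \<open>D\<degree>\<close> with respect to \<open>C\<close>; it is the same for all charts sending \<open>D\<close> to infinity.\<close>

definition line_barycenter :: "'b set \<Rightarrow> 'b set set \<Rightarrow> 'b set set \<Rightarrow> 'b set" where
  "line_barycenter W C D =
     (THE q. proper_open_convex W C \<and> avoiding_line W C D \<and>
        (\<exists>\<phi>. affine_parametrization W D \<phi> \<and> q = \<phi> (center_of_gravity (\<phi> -` C))))"

end

interpretation real_dual: real_proj_space dual_scale
  by unfold_locales

context real_proj_space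
begin

definition dual_convex :: "'b set set \<Rightarrow> ('b \<Rightarrow> real) set set" where
  "dual_convex C = {line_dual L | L. avoiding_line UNIV C L}"

definition convex_polar_wrt :: "'b set set \<Rightarrow> 'b set \<Rightarrow> 'b set set" where
  "convex_polar_wrt C x =
     dual_point_dual (real_dual.line_barycenter dual_space (dual_convex C) (point_dual x))"

definition convex_polar ::
  "'b set \<Rightarrow> 'b set \<Rightarrow> 'b set \<Rightarrow> 'b set \<Rightarrow> 'b set set" where
  "convex_polar p1 p2 p3 p =
     convex_polar_wrt
       (connected_component_of_set
          (subtopology (proj_topology UNIV)
             (Proj UNIV - (proj_join p2 p3 \<union> proj_join p1 p3 \<union> proj_join p1 p2))) p) p"

end

end

theory Submission
  imports Defs
begin

text \<open>
  All four polars are the same line for one reason: in a basis \<open>(b1, b2, b3)\<close> adapted to the frame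
  \<open>(p1, p2, p3, p)\<close> (lemma \<open>frame_exists\<close>) each of them is the line \<open>x + y + z = 0\<close>, called
  \<open>Proj (zero_sum_plane b1 b2 b3)\<close> below.

  For the frame polar, the fourth point of the dual frame is the class of \<open>b1* + b2* + b3*\<close>
  (lemma \<open>frame_polar_eq\<close>). For the harmonic polar, \<open>(p1 p)\<close> meets \<open>(p2 p3)\<close> in the class of
  \<open>b2 + b3\<close>, whose harmonic conjugate is that of \<open>- b2 + b3\<close>; the three such vectors span the
  zero-sum plane (lemma \<open>harmonic_polar_eq\<close>). For the cubic polar, \<open>C\<close> is a multiple of
  \<open>b1* b2* b3*\<close>, and its polar form at \<open>u = b1 + b2 + b3\<close> satisfies \<open>\<psi>(u, u, v) = (x + y + z) / 3\<close> up to
  that factor (lemma \<open>cubic_polar_eq\<close>).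

  For the convex polar, the component of \<open>p\<close> in the complement of the sides is the open octant
  \<open>x, y, z > 0\<close> (lemma \<open>octant_is_component\<close>). A line avoids the closed octant iff it is the kernel of
  a form that is positive on \<open>b1, b2, b3\<close>, so the dual convex set is the octant of the dual basis
  (lemma \<open>dual_convex_octant\<close>), and the line dual to \<open>p\<close> is the zero-sum line of the dual basis. In
  an affine chart that sends this line to infinity the octant is a triangle whose vertices are the
  three basis points. The center of gravity of a triangle is fixed by the affine map that permutes
  its vertices cyclically, so its barycentric coordinates are equal (lemma
  \<open>center_of_gravity_triangle\<close>) and it is the class of \<open>b1* + b2* + b3*\<close>, the point that also
  defines the frame polar. Points, lines and topology are treated relative to a three-dimensional
  space \<open>W\<close>, because the octant and its barycenter occur in the plane and in its dual.
\<close>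

section \<open>Projective points and bases of a three-dimensional space\<close>

context proj_space
begin

lemma pt_eq_range: "pt v = range (\<lambda>c. scale c v)"
  by (simp add: pt_def span_singleton)

lemma pt_eq_pt_iff:
  assumes "v \<noteq> 0"
  shows "pt v = pt w \<longleftrightarrow> (\<exists>c. c \<noteq> 0 \<and> w = scale c v)"
proof
  assume eq: "pt v = pt w"
  have "v \<in> pt w" "w \<in> pt v"
    using eq by (auto simp: pt_def intro: span_base)
  then obtain c d where w: "w = scale c v" and v: "v = scale d w"
    unfolding pt_eq_range by blast
  have "w \<noteq> 0" using v assms by (metis scale_zero_right)
  then have "c \<noteq> 0" using w by (metis scale_zero_left)
  with w show "\<exists>c. c \<noteq> 0 \<and> w = scale c v" by blast
next
  assume "\<exists>c. c \<noteq> 0 \<and> w = scale c v"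
  then obtain c where c: "c \<noteq> 0" "w = scale c v" by blast
  then have v: "v = scale (inverse c) w" by simp
  show "pt v = pt w"
    unfolding pt_def
  proof (rule antisym; rule span_minimal)
    show "{v} \<subseteq> span {w}" by (subst v) (simp add: span_scale span_base)
    show "{w} \<subseteq> span {v}" by (simp add: c span_scale span_base)
  qed simp_all
qed

lemma pt_scale: "c \<noteq> 0 \<Longrightarrow> pt (scale c v) = pt v"
  using pt_eq_pt_iff[of v "scale c v"] by (cases "v = 0") auto

lemma pt_mem_Proj_iff:
  assumes "subspace S" "v \<noteq> 0"
  shows "pt v \<in> Proj S \<longleftrightarrow> v \<in> S"
proof
  assume "pt v \<in> Proj S"
  then obtain w where "pt w = pt v" "w \<in> S" "w \<noteq> 0" by (auto simp: Proj_def)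
  then obtain c where "v = scale c w" using pt_eq_pt_iff by blast
  with \<open>w \<in> S\<close> show "v \<in> S" using assms subspace_scale by blast
qed (use assms in \<open>auto simp: Proj_def\<close>)

lemma Proj_mono_iff:
  assumes "subspace S" "subspace T"
  shows "Proj S \<subseteq> Proj T \<longleftrightarrow> S \<subseteq> T"
proof
  assume sub: "Proj S \<subseteq> Proj T"
  show "S \<subseteq> T"
  proof
    fix v assume "v \<in> S"
    show "v \<in> T"
    proof (cases "v = 0")
      case False
      then have "pt v \<in> Proj S" using \<open>v \<in> S\<close> by (auto simp: Proj_def)
      then show ?thesis using sub assms(2) False pt_mem_Proj_iff by blast
    qed (use assms(2) subspace_0 in auto)
  qed
qed (auto simp: Proj_def)

lemma Proj_eq_iff:
  "subspace S \<Longrightarrow> subspace T \<Longrightarrow> Proj S = Proj T \<longleftrightarrow> S = T"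
  using Proj_mono_iff by (metis order_antisym_conv order_refl)

lemma proj_join_pt: "proj_join (pt a) (pt b) = Proj (span {a, b})"
proof -
  have "span (span {a} \<union> span {b}) = span {a, b}"
  proof (rule antisym; rule span_minimal)
    show "span {a} \<union> span {b} \<subseteq> span {a, b}"
      by (intro Un_least span_mono) auto
    show "{a, b} \<subseteq> span (span {a} \<union> span {b})"
      by (auto intro!: span_base)
  qed simp_all
  then show ?thesis by (simp add: proj_join_def pt_def)
qed

definition comb3 :: "'b \<Rightarrow> 'b \<Rightarrow> 'b \<Rightarrow> 'a \<Rightarrow> 'a \<Rightarrow> 'a \<Rightarrow> 'b" where
  "comb3 b1 b2 b3 x y z = scale x b1 + scale y b2 + scale z b3"

lemma span2: "v \<in> span {a, b} \<longleftrightarrow> (\<exists>x y. v = scale x a + scale y b)"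
  by (simp add: span_breakdown_eq algebra_simps)

lemma span3: "v \<in> span {a, b, c} \<longleftrightarrow> (\<exists>x y z. v = comb3 a b c x y z)"
  by (simp add: span_breakdown_eq algebra_simps comb3_def)

lemma span_solve:
  assumes "scale x v + w = 0" "x \<noteq> 0" "w \<in> span S"
  shows "v \<in> span S"
proof -
  have "scale x v = - w" using assms(1) by (simp add: eq_neg_iff_add_eq_0)
  then have "v = scale (inverse x) (- w)"
    using assms(2) by (metis left_inverse scale_one scale_scale)
  then show ?thesis using assms(3) by (simp add: span_neg span_scale)
qed

lemma independent2_iff:
  "a \<noteq> b \<and> independent {a, b} \<longleftrightarrow> (\<forall>x y. scale x a + scale y b = 0 \<longrightarrow> x = 0 \<and> y = 0)"
  (is "?L \<longleftrightarrow> ?R")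
proof -
  have L: "?L \<longleftrightarrow> b \<noteq> 0 \<and> a \<notin> span {b}"
    by (auto simp: independent_insert intro: span_base)
  show ?thesis
  proof
    assume l: ?L
    show ?R
    proof (intro allI impI)
      fix x y assume eq: "scale x a + scale y b = 0"
      have "x = 0"
        using span_solve[OF eq, of "{b}"] l[unfolded L] by (auto simp: span_scale span_base)
      then show "x = 0 \<and> y = 0" using eq l[unfolded L] by auto
    qed
  next
    assume r: ?R
    have "b \<noteq> 0" using r[rule_format, of 0 1] by auto
    moreover have "a \<notin> span {b}"
    proof
      assume "a \<in> span {b}"
      then obtain k where "a = scale k b" by (auto simp: span_singleton)
      then show False using r[rule_format, of "-1" k] by auto
    qed
    ultimately show ?L unfolding L by blast
  qed
qed

lemma is_basis3_iff:
  "is_basis3 W b1 b2 b3 \<longleftrightarrow>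
     W = {v. \<exists>x y z. v = comb3 b1 b2 b3 x y z} \<and>
     (\<forall>x y z. comb3 b1 b2 b3 x y z = 0 \<longrightarrow> x = 0 \<and> y = 0 \<and> z = 0)"
  (is "_ \<longleftrightarrow> ?A \<and> ?R")
proof -
  have L: "distinct [b1, b2, b3] \<and> independent {b1, b2, b3} \<longleftrightarrow>
           (b2 \<noteq> b3 \<and> independent {b2, b3}) \<and> b1 \<notin> span {b2, b3}" (is "?L \<longleftrightarrow> _")
    by (auto simp: independent_insert[of b1] intro: span_base)
  have "?L \<longleftrightarrow> ?R"
  proof
    assume l: ?L
    show ?R
    proof (intro allI impI)
      fix x y z assume eq: "comb3 b1 b2 b3 x y z = 0"
      then have eq': "scale x b1 + (scale y b2 + scale z b3) = 0"
        by (simp add: comb3_def add.assoc)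
      have "x = 0"
        using span_solve[OF eq', of "{b2, b3}"] l[unfolded L]
        by (auto simp: span_scale span_base span_add)
      then show "x = 0 \<and> y = 0 \<and> z = 0"
        using eq' l[unfolded L independent2_iff] by auto
    qed
  next
    assume r: ?R
    have "b1 \<notin> span {b2, b3}"
    proof
      assume "b1 \<in> span {b2, b3}"
      then obtain y z where "b1 = scale y b2 + scale z b3" by (auto simp: span2)
      then show False using r[rule_format, of "-1" y z] by (auto simp: comb3_def)
    qed
    moreover have "b2 \<noteq> b3 \<and> independent {b2, b3}"
      unfolding independent2_iff using r[rule_format, of 0] by (auto simp: comb3_def)
    ultimately show ?L unfolding L by blast
  qed
  moreover have "span {b1, b2, b3} = {v. \<exists>x y z. v = comb3 b1 b2 b3 x y z}"
    using span3 by blast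
  ultimately show ?thesis unfolding is_basis3_def by auto
qed

lemma comb3_add: "comb3 b1 b2 b3 x y z + comb3 b1 b2 b3 x' y' z' = comb3 b1 b2 b3 (x + x') (y + y') (z + z')"
  by (simp add: comb3_def algebra_simps)

lemma comb3_diff: "comb3 b1 b2 b3 x y z - comb3 b1 b2 b3 x' y' z' = comb3 b1 b2 b3 (x - x') (y - y') (z - z')"
  by (simp add: comb3_def algebra_simps)

lemma scale_comb3: "scale c (comb3 b1 b2 b3 x y z) = comb3 b1 b2 b3 (c * x) (c * y) (c * z)"
  by (simp add: comb3_def algebra_simps)

lemma basis3_comb3_mem: "is_basis3 W b1 b2 b3 \<Longrightarrow> comb3 b1 b2 b3 x y z \<in> W"
  by (auto simp: is_basis3_iff)

lemma basis3_obtain: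
  assumes "is_basis3 W b1 b2 b3" "v \<in> W"
  obtains x y z where "v = comb3 b1 b2 b3 x y z"
  using assms by (auto simp: is_basis3_iff)

lemma basis3_comb3_eq_iff:
  assumes "is_basis3 W b1 b2 b3"
  shows "comb3 b1 b2 b3 x y z = comb3 b1 b2 b3 x' y' z' \<longleftrightarrow> x = x' \<and> y = y' \<and> z = z'"
proof
  assume "comb3 b1 b2 b3 x y z = comb3 b1 b2 b3 x' y' z'"
  then have "comb3 b1 b2 b3 (x - x') (y - y') (z - z') = 0"
    by (simp add: comb3_diff[symmetric])
  then have "x - x' = 0 \<and> y - y' = 0 \<and> z - z' = 0"
    using assms unfolding is_basis3_iff by blast
  then show "x = x' \<and> y = y' \<and> z = z'" by simp
qed simp

lemma basis3_comb3_eq_0_iff: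
  assumes "is_basis3 W b1 b2 b3"
  shows "comb3 b1 b2 b3 x y z = 0 \<longleftrightarrow> x = 0 \<and> y = 0 \<and> z = 0"
  using basis3_comb3_eq_iff[OF assms, of x y z 0 0 0] by (simp add: comb3_def)

lemma basis3_rotate: "is_basis3 W b1 b2 b3 \<Longrightarrow> is_basis3 W b2 b3 b1"
  by (auto simp: is_basis3_def insert_commute)

lemma basis3_scale:
  assumes "is_basis3 W b1 b2 b3" "a \<noteq> 0" "b \<noteq> 0" "c \<noteq> 0"
  shows "is_basis3 W (scale a b1) (scale b b2) (scale c b3)"
proof -
  have 1: "comb3 (scale a b1) (scale b b2) (scale c b3) x y z = comb3 b1 b2 b3 (a * x) (b * y) (c * z)" for x y z
    by (simp add: comb3_def mult.commute)
  have 2: "comb3 b1 b2 b3 x y z =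
    comb3 (scale a b1) (scale b b2) (scale c b3) (x / a) (y / b) (z / c)" for x y z
    using assms by (simp add: 1)
  have "W = {v. \<exists>x y z. v = comb3 (scale a b1) (scale b b2) (scale c b3) x y z}"
  proof (intro set_eqI iffI; clarify)
    fix v assume "v \<in> W"
    then obtain x y z where "v = comb3 b1 b2 b3 x y z" using basis3_obtain[OF assms(1)] by blast
    then show "\<exists>x y z. v = comb3 (scale a b1) (scale b b2) (scale c b3) x y z"
      unfolding 2 by blast
  next
    fix x y z show "comb3 (scale a b1) (scale b b2) (scale c b3) x y z \<in> W"
      unfolding 1 by (rule basis3_comb3_mem[OF assms(1)])
  qed
  moreover have "x = 0 \<and> y = 0 \<and> z = 0"
    if "comb3 (scale a b1) (scale b b2) (scale c b3) x y z = 0" for x y z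
    using that assms basis3_comb3_eq_0_iff[OF assms(1)] by (auto simp: 1)
  ultimately show ?thesis
    unfolding is_basis3_iff by simp
qed

lemma basis3_dim: "is_basis3 W b1 b2 b3 \<Longrightarrow> dim W = 3"
  by (auto simp: is_basis3_def dim_eq_card_independent)

lemma subspace_eq_UNIV:
  assumes "dim UNIV = 3" "subspace S" "dim S = 3"
  shows "S = UNIV"
proof -
  obtain B where B: "B \<subseteq> S" "independent B" "S \<subseteq> span B" "card B = 3"
    using basis_exists[of S] assms(3) by metis
  obtain B' where B': "B \<subseteq> B'" "independent B'" "UNIV \<subseteq> span B'"
    using maximal_independent_subset_extend[of B UNIV] B by auto
  have "card B' = 3" using B' assms(1) basis_card_eq_dim[of B' UNIV] by simp
  then have "B = B'" using B B'(1) by (metis card_subset_eq card.infinite zero_neq_numeral)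
  then show ?thesis using B' B assms(2) span_minimal by blast
qed

text \<open>Three vectors that do not form a basis have a maximal independent subset of at most two elements,
  which extends to a two-element part of a basis of the whole space. This covers repeated and
  zero vectors as well, so degenerate triples need no separate treatment.\<close>

lemma plane_through:
  assumes "dim UNIV = 3" "\<not> is_basis3 UNIV a b c"
  obtains S where "subspace S" "dim S = 2" "a \<in> S" "b \<in> S" "c \<in> S"
proof -
  obtain B where B: "B \<subseteq> {a, b, c}" "independent B" "{a, b, c} \<subseteq> span B"
    using maximal_independent_subset[of "{a, b, c}"] by metis
  have "card B \<le> 2"
  proof (rule ccontr)
    assume "\<not> card B \<le> 2"
    moreover have "card B \<le> card {a, b, c}" "card {a, b, c} \<le> 3"
      using card_mono[OF _ B(1)] by (simp_all add: card_insert_if)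
    ultimately have c: "card B = 3" "card {a, b, c} = 3" by auto
    then have "B = {a, b, c}" using B by (intro card_subset_eq) auto
    moreover from this have "span B = UNIV"
      using c B assms(1) by (intro subspace_eq_UNIV) (auto simp: dim_eq_card_independent)
    moreover have "distinct [a, b, c]" using c(2) by (auto simp: card_insert_if split: if_splits)
    ultimately show False using assms(2) B unfolding is_basis3_def by simp
  qed
  obtain B' where B': "B \<subseteq> B'" "independent B'" "UNIV \<subseteq> span B'"
    using maximal_independent_subset_extend[of B UNIV] B by auto
  have card: "card B' = 3" using B' assms(1) basis_card_eq_dim[of B' UNIV] by simp
  then have fin: "finite B'" by (metis card.infinite zero_neq_numeral)
  obtain T where T: "B \<subseteq> T" "T \<subseteq> B'" "card T = 2"
    using exists_subset_between[of B 2 B'] card \<open>card B \<le> 2\<close> B'(1) fin by auto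
  have "independent T" using T(2) B'(2) independent_mono by blast
  then have "dim (span T) = 2" using T(3) by (simp add: dim_eq_card_independent)
  moreover have "{a, b, c} \<subseteq> span T" using B(3) span_mono[OF T(1)] by blast
  ultimately show ?thesis using that[of "span T"] by simp
qed

lemma triangle_basis:
  assumes "dim UNIV = 3" "triangle (pt a) (pt b) (pt c)" "a \<noteq> 0" "b \<noteq> 0" "c \<noteq> 0"
  shows "is_basis3 UNIV a b c"
proof (rule ccontr)
  assume "\<not> ?thesis"
  then obtain S where S: "subspace S" "dim S = 2" "a \<in> S" "b \<in> S" "c \<in> S"
    using plane_through assms(1) by blast
  then have "proj_line UNIV (Proj S)" by (auto simp: proj_line_def)
  moreover have "pt a \<in> Proj S" "pt b \<in> Proj S" "pt c \<in> Proj S"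
    using S assms by (auto simp: Proj_def)
  ultimately show False using assms(2) unfolding triangle_def by blast
qed

text \<open>Genericity says that all three coordinates of \<open>p\<close> in a basis carried by the triangle are nonzero;
  absorbing them into the basis vectors gives an adapted basis.\<close>

lemma frame_exists:
  assumes "dim UNIV = 3" "triangle p1 p2 p3" "generic p1 p2 p3 p"
  obtains b1 b2 b3 where "is_basis3 UNIV b1 b2 b3"
    "p1 = pt b1" "p2 = pt b2" "p3 = pt b3" "p = pt (b1 + b2 + b3)"
proof -
  obtain a b c u where nz: "a \<noteq> 0" "b \<noteq> 0" "c \<noteq> 0" "u \<noteq> 0"
    and p: "p1 = pt a" "p2 = pt b" "p3 = pt c" "p = pt u"
    using assms(2,3) by (auto simp: triangle_def generic_def Proj_def)
  have bas: "is_basis3 UNIV a b c" using triangle_basis assms(1,2) nz p by blast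
  obtain x y z where u: "u = comb3 a b c x y z" using basis3_obtain[OF bas] by blast
  have sides: "u \<notin> span {b, c}" "u \<notin> span {a, c}" "u \<notin> span {a, b}"
    using assms(3) nz unfolding generic_def p proj_join_pt by (auto simp: pt_mem_Proj_iff)
  have "x \<noteq> 0" "y \<noteq> 0" "z \<noteq> 0"
    using sides by (auto simp: u comb3_def span_add span_scale span_base)
  with bas show ?thesis
    by (intro that[of "scale x a" "scale y b" "scale z c"])
       (simp_all add: p u basis3_scale pt_scale, simp add: comb3_def)
qed

end

section \<open>The harmonic polar\<close>

context proj_space
begin

definition zero_sum_plane :: "'b \<Rightarrow> 'b \<Rightarrow> 'b \<Rightarrow> 'b set" where
  "zero_sum_plane b1 b2 b3 = {comb3 b1 b2 b3 x y z | x y z. x + y + z = 0}"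

text \<open>The two vectors witnessing the harmonic relation are determined up to a common scalar, because the
  class of their sum is prescribed. This is what makes the fourth point unique.\<close>

lemma fourth_harmonic_eq:
  assumes "a \<noteq> b" "independent {a, b}"
  shows "fourth_harmonic (pt a) (pt b) (pt (a + b)) = pt (- a + b)"
  unfolding fourth_harmonic_def
proof (rule the_equality)
  show "\<exists>x y. x \<noteq> y \<and> independent {x, y} \<and> pt a = pt x \<and> pt b = pt y \<and>
          pt (a + b) = pt (x + y) \<and> pt (- a + b) = pt (- x + y)"
    using assms by blast
next
  fix d assume "\<exists>x y. x \<noteq> y \<and> independent {x, y} \<and> pt a = pt x \<and> pt b = pt y \<and>
          pt (a + b) = pt (x + y) \<and> d = pt (- x + y)"
  then obtain x y where xy: "pt a = pt x" "pt b = pt y" "pt (a + b) = pt (x + y)" "d = pt (- x + y)"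
    by blast
  have ind: "\<forall>x y. scale x a + scale y b = 0 \<longrightarrow> x = 0 \<and> y = 0"
    using assms independent2_iff by blast
  have nz: "a \<noteq> 0" "b \<noteq> 0" "a + b \<noteq> 0"
    using ind[rule_format, of 1 0] ind[rule_format, of 0 1] ind[rule_format, of 1 1] by auto
  obtain s t r where str: "s \<noteq> 0" "x = scale s a" "y = scale t b" "x + y = scale r (a + b)"
    using xy nz by (auto simp: pt_eq_pt_iff)
  then have "scale (s - r) a + scale (t - r) b = 0"
    by (simp add: algebra_simps)
  then have "s = r" "t = r" using ind by fastforce+
  then have "- x + y = scale s (- a + b)" using str by (simp add: algebra_simps)
  then show "d = pt (- a + b)" using xy(4) str(1) pt_scale by metis
qed

lemma meet_point_eq:
  assumes "is_basis3 W b1 b2 b3"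
  shows "meet_point (proj_join (pt b1) (pt (b1 + b2 + b3))) (proj_join (pt b2) (pt b3)) = pt (b2 + b3)"
proof -
  have nz: "b2 + b3 \<noteq> 0"
    using basis3_comb3_eq_0_iff[OF assms, of 0 1 1] by (simp add: comb3_def)
  have iff: "v \<in> span {b1, b1 + b2 + b3} \<and> v \<in> span {b2, b3} \<longleftrightarrow> (\<exists>c. v = scale c (b2 + b3))" for v
  proof
    assume "v \<in> span {b1, b1 + b2 + b3} \<and> v \<in> span {b2, b3}"
    then obtain x y s t where v: "v = scale x b1 + scale y (b1 + b2 + b3)" "v = scale s b2 + scale t b3"
      unfolding span2 by blast
    then have "comb3 b1 b2 b3 (x + y) y y = comb3 b1 b2 b3 0 s t"
      by (simp add: comb3_def algebra_simps)
    then have "s = y" "t = y" using basis3_comb3_eq_iff[OF assms] by auto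
    then show "\<exists>c. v = scale c (b2 + b3)" using v(2) by (auto simp: algebra_simps)
  next
    assume "\<exists>c. v = scale c (b2 + b3)"
    then obtain c where "v = scale c (b2 + b3)" by blast
    then have "v = scale (- c) b1 + scale c (b1 + b2 + b3)" "v = scale c b2 + scale c b3"
      by (simp_all add: algebra_simps)
    then show "v \<in> span {b1, b1 + b2 + b3} \<and> v \<in> span {b2, b3}"
      unfolding span2 by blast
  qed
  have "Proj (span {b1, b1 + b2 + b3}) \<inter> Proj (span {b2, b3}) = {pt (b2 + b3)}"
  proof (rule antisym; rule subsetI)
    fix q assume q: "q \<in> Proj (span {b1, b1 + b2 + b3}) \<inter> Proj (span {b2, b3})"
    then obtain v where v: "q = pt v" "v \<noteq> 0" by (auto simp: Proj_def)
    then obtain c where "v = scale c (b2 + b3)"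
      using q iff by (auto simp: pt_mem_Proj_iff)
    then show "q \<in> {pt (b2 + b3)}" using v pt_scale by auto
  next
    fix q assume "q \<in> {pt (b2 + b3)}"
    then show "q \<in> Proj (span {b1, b1 + b2 + b3}) \<inter> Proj (span {b2, b3})"
      using nz iff[of "b2 + b3"] by (simp add: pt_mem_Proj_iff) (metis scale_one)
  qed
  then show ?thesis unfolding meet_point_def proj_join_pt by auto
qed

text \<open>The point \<open>u'\<^sub>1\<close>; the other two follow by rotating the basis, which fixes \<open>b1 + b2 + b3\<close>.\<close>

lemma harmonic_vertex:
  assumes "is_basis3 W b1 b2 b3"
  shows "fourth_harmonic (pt b2) (pt b3)
    (meet_point (proj_join (pt b1) (pt (b1 + b2 + b3))) (proj_join (pt b2) (pt b3))) = pt (- b2 + b3)"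
proof -
  have "b2 \<noteq> b3" "independent {b2, b3}"
    using assms independent_mono[of "{b1, b2, b3}" "{b2, b3}"] by (auto simp: is_basis3_def)
  then show ?thesis
    unfolding meet_point_eq[OF assms] by (rule fourth_harmonic_eq)
qed

lemma harmonic_polar_eq:
  assumes "is_basis3 W b1 b2 b3"
  shows "harmonic_polar (pt b1) (pt b2) (pt b3) (pt (b1 + b2 + b3)) =
    Proj (zero_sum_plane b1 b2 b3)"
proof -
  note b231 = basis3_rotate[OF assms] and b312 = basis3_rotate[OF basis3_rotate[OF assms]]
  have "span (pt (- b2 + b3) \<union> pt (- b3 + b1) \<union> pt (- b1 + b2)) = span {- b2 + b3, - b3 + b1, - b1 + b2}"
  proof (rule antisym; rule span_minimal)
    show "pt (- b2 + b3) \<union> pt (- b3 + b1) \<union> pt (- b1 + b2) \<subseteq> span {- b2 + b3, - b3 + b1, - b1 + b2}"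
      unfolding pt_def by (intro Un_least span_mono) auto
    show "{- b2 + b3, - b3 + b1, - b1 + b2} \<subseteq> span (pt (- b2 + b3) \<union> pt (- b3 + b1) \<union> pt (- b1 + b2))"
      by (auto simp: pt_def intro!: span_base)
  qed simp_all
  also have "\<dots> = zero_sum_plane b1 b2 b3"
  proof -
    have 1: "comb3 (- b2 + b3) (- b3 + b1) (- b1 + b2) r s t = comb3 b1 b2 b3 (s - t) (t - r) (r - s)" for r s t
      by (simp add: comb3_def algebra_simps)
    have 2: "comb3 b1 b2 b3 x y z = comb3 (- b2 + b3) (- b3 + b1) (- b1 + b2) (- y) x 0"
      if "x + y + z = 0" for x y z
    proof -
      have "z = - y - x" using that by (simp add: algebra_simps eq_neg_iff_add_eq_0)
      then show ?thesis unfolding 1 by simp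
    qed
    have "(\<exists>r s t. v = comb3 (- b2 + b3) (- b3 + b1) (- b1 + b2) r s t) \<longleftrightarrow>
      (\<exists>x y z. v = comb3 b1 b2 b3 x y z \<and> x + y + z = 0)" for v
    proof
      assume "\<exists>r s t. v = comb3 (- b2 + b3) (- b3 + b1) (- b1 + b2) r s t"
      then obtain r s t where "v = comb3 b1 b2 b3 (s - t) (t - r) (r - s)" unfolding 1 by blast
      moreover have "(s - t) + (t - r) + (r - s) = 0" by simp
      ultimately show "\<exists>x y z. v = comb3 b1 b2 b3 x y z \<and> x + y + z = 0" by blast
    qed (use 2 in blast)
    then show ?thesis by (simp add: set_eq_iff span3 zero_sum_plane_def)
  qed
  finally have span: "span (pt (- b2 + b3) \<union> pt (- b3 + b1) \<union> pt (- b1 + b2)) = \<dots>" .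
  have sum: "b2 + b3 + b1 = b1 + b2 + b3" "b3 + b1 + b2 = b1 + b2 + b3" by (simp_all add: add_ac)
  show ?thesis
    unfolding harmonic_polar_def Let_def harmonic_vertex[OF assms]
      harmonic_vertex[OF b231, unfolded sum] harmonic_vertex[OF b312, unfolded sum] span ..
qed

end

section \<open>Linear forms, dual bases and the frame polar\<close>

context proj_space
begin

lemma linear_form_iff:
  "linear_form f \<longleftrightarrow> (\<forall>u v. f (u + v) = f u + f v) \<and> (\<forall>c v. f (scale c v) = c * f v)"
proof -
  have "vector_space ((*) :: 'a \<Rightarrow> 'a \<Rightarrow> 'a)"
    by unfold_locales (auto simp: algebra_simps)
  then show ?thesis
    unfolding linear_form_def Vector_Spaces.linear_iff using vector_space_axioms by auto
qed

lemma linear_form_comb3: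
  "linear_form f \<Longrightarrow> f (comb3 b1 b2 b3 x y z) = x * f b1 + y * f b2 + z * f b3"
  by (simp add: linear_form_iff comb3_def)

lemma linear_form_0: "linear_form f \<Longrightarrow> f 0 = 0"
  by (metis linear_form_iff mult_zero_left scale_zero_left)

lemma subspace_kernel_form: "linear_form f \<Longrightarrow> subspace {v. f v = 0}"
  using linear_form_0 by (auto simp: subspace_def linear_form_iff)

lemma linear_form_add: "linear_form f \<Longrightarrow> linear_form g \<Longrightarrow> linear_form (f + g)"
  by (auto simp: linear_form_iff algebra_simps)

lemma linear_form_scale: "linear_form f \<Longrightarrow> linear_form (dual_scale c f)"
  by (auto simp: linear_form_iff dual_scale_def algebra_simps)

lemma linear_form_dual_comb3:
  "linear_form f \<Longrightarrow> linear_form g \<Longrightarrow> linear_form h \<Longrightarrow> linear_form (dual.comb3 f g h x y z)"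
  by (simp add: dual.comb3_def linear_form_add linear_form_scale)

lemma linear_form_eqI:
  assumes "is_basis3 UNIV b1 b2 b3" "linear_form f" "linear_form g"
    and "f b1 = g b1" "f b2 = g b2" "f b3 = g b3"
  shows "f = g"
proof
  fix v
  obtain x y z where "v = comb3 b1 b2 b3 x y z" using basis3_obtain[OF assms(1)] by blast
  then show "f v = g v" using assms by (simp add: linear_form_comb3)
qed

lemma linear_form_exists:
  assumes "is_basis3 UNIV b1 b2 b3"
  obtains f where "linear_form f" "f b1 = r" "f b2 = s" "f b3 = t"
proof -
  define f where "f v = (THE c. \<exists>x y z. v = comb3 b1 b2 b3 x y z \<and> c = x * r + y * s + z * t)" for v
  have f: "f (comb3 b1 b2 b3 x y z) = x * r + y * s + z * t" for x y z
    unfolding f_def using basis3_comb3_eq_iff[OF assms] by (intro the_equality) auto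
  have "linear_form f"
    unfolding linear_form_iff
  proof safe
    fix u v
    obtain x y z where u: "u = comb3 b1 b2 b3 x y z" using basis3_obtain[OF assms] by blast
    obtain x' y' z' where v: "v = comb3 b1 b2 b3 x' y' z'" using basis3_obtain[OF assms] by blast
    show "f (u + v) = f u + f v" by (simp add: u v comb3_add f algebra_simps)
  next
    fix c v
    obtain x y z where v: "v = comb3 b1 b2 b3 x y z" using basis3_obtain[OF assms] by blast
    show "f (scale c v) = c * f v" by (simp add: v scale_comb3 f algebra_simps)
  qed
  moreover have "f b1 = r" "f b2 = s" "f b3 = t"
    using f[of 1 0 0] f[of 0 1 0] f[of 0 0 1] by (simp_all add: comb3_def)
  ultimately show ?thesis using that by blast
qed

lemma dual_basis3_exists:
  assumes "is_basis3 UNIV b1 b2 b3"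
  obtains f1 f2 f3 where "dual_basis3 b1 b2 b3 f1 f2 f3"
proof -
  obtain f1 where "linear_form f1" "f1 b1 = 1" "f1 b2 = 0" "f1 b3 = 0"
    using linear_form_exists[OF assms] by blast
  moreover obtain f2 where "linear_form f2" "f2 b1 = 0" "f2 b2 = 1" "f2 b3 = 0"
    using linear_form_exists[OF assms] by blast
  moreover obtain f3 where "linear_form f3" "f3 b1 = 0" "f3 b2 = 0" "f3 b3 = 1"
    using linear_form_exists[OF assms] by blast
  ultimately show ?thesis using that unfolding dual_basis3_def by blast
qed

lemma dual_basis3_comb3:
  assumes "dual_basis3 b1 b2 b3 f1 f2 f3"
  shows "f1 (comb3 b1 b2 b3 x y z) = x" "f2 (comb3 b1 b2 b3 x y z) = y" "f3 (comb3 b1 b2 b3 x y z) = z"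
  using assms by (simp_all add: dual_basis3_def linear_form_comb3)

lemma linear_form_dual_expansion:
  assumes "is_basis3 UNIV b1 b2 b3" "dual_basis3 b1 b2 b3 f1 f2 f3" "linear_form g"
  shows "g = dual.comb3 f1 f2 f3 (g b1) (g b2) (g b3)"
  using assms(2,3)
  by (intro linear_form_eqI[OF assms(1)] linear_form_dual_comb3)
     (simp_all add: dual_basis3_def dual.comb3_def dual_scale_def)

lemma dual_basis3_is_basis3:
  assumes "is_basis3 UNIV b1 b2 b3" "dual_basis3 b1 b2 b3 f1 f2 f3"
  shows "dual.is_basis3 dual_space f1 f2 f3"
  unfolding dual.is_basis3_iff
proof (intro conjI allI impI set_eqI iffI)
  fix g assume "g \<in> dual_space"
  then show "g \<in> {v. \<exists>x y z. v = dual.comb3 f1 f2 f3 x y z}"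
    using linear_form_dual_expansion[OF assms] by (auto simp: dual_space_def)
next
  fix g assume "g \<in> {v. \<exists>x y z. v = dual.comb3 f1 f2 f3 x y z}"
  then show "g \<in> dual_space"
    using assms(2) by (auto simp: dual_space_def dual_basis3_def linear_form_dual_comb3)
next
  fix x y z assume eq: "dual.comb3 f1 f2 f3 x y z = 0"
  have *: "dual.comb3 f1 f2 f3 x y z b1 = x" "dual.comb3 f1 f2 f3 x y z b2 = y"
       "dual.comb3 f1 f2 f3 x y z b3 = z"
    using assms(2) by (simp_all add: dual.comb3_def dual_basis3_def dual_scale_def)
  show "x = 0" "y = 0" "z = 0" using *[symmetric] unfolding eq by simp_all
qed

lemma dual_point_dual_pt: "dual_point_dual (dual.pt f) = kernel_line f"
proof -
  have "(\<forall>g\<in>dual.pt f. g v = 0) \<longleftrightarrow> f v = 0" for v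
    unfolding dual.pt_eq_range by (auto simp: dual_scale_def dest: spec[of _ 1])
  then show ?thesis by (simp add: dual_point_dual_def kernel_line_def)
qed

lemma kernel_line_sum_dual_basis:
  assumes "is_basis3 UNIV b1 b2 b3" "dual_basis3 b1 b2 b3 f1 f2 f3"
  shows "kernel_line (f1 + f2 + f3) = Proj (zero_sum_plane b1 b2 b3)"
proof -
  have "v \<in> {v. (f1 + f2 + f3) v = 0} \<longleftrightarrow> v \<in> zero_sum_plane b1 b2 b3" for v
  proof -
    obtain x y z where "v = comb3 b1 b2 b3 x y z" using basis3_obtain[OF assms(1)] by blast
    then show ?thesis
      using basis3_comb3_eq_iff[OF assms(1)]
      by (auto simp: dual_basis3_comb3[OF assms(2)] zero_sum_plane_def)
  qed
  then have "{v. (f1 + f2 + f3) v = 0} = zero_sum_plane b1 b2 b3" by blast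
  then show ?thesis by (simp add: kernel_line_def)
qed

text \<open>Two bases adapted to the same frame differ by a common scalar \<open>s\<close>, hence their dual bases differ by
  \<open>inverse s\<close>. The points of the dual frame are therefore well defined and can be computed from
  any adapted basis.\<close>

lemma frame_polar_eq:
  assumes "is_basis3 UNIV b1 b2 b3"
  shows "frame_polar (pt b1) (pt b2) (pt b3) (pt (b1 + b2 + b3)) = Proj (zero_sum_plane b1 b2 b3)"
proof -
  obtain f1 f2 f3 where f: "dual_basis3 b1 b2 b3 f1 f2 f3"
    using dual_basis3_exists[OF assms] by blast
  have nz: "b1 \<noteq> 0" "b2 \<noteq> 0" "b3 \<noteq> 0" "b1 + b2 + b3 \<noteq> 0"
    using basis3_comb3_eq_0_iff[OF assms, of 1 0 0] basis3_comb3_eq_0_iff[OF assms, of 0 1 0]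
      basis3_comb3_eq_0_iff[OF assms, of 0 0 1] basis3_comb3_eq_0_iff[OF assms, of 1 1 1]
    by (simp_all add: comb3_def)
  have "dual_frame (pt b1, pt b2, pt b3, pt (b1 + b2 + b3)) =
    (dual.pt f1, dual.pt f2, dual.pt f3, dual.pt (f1 + f2 + f3))" (is "dual_frame ?R = ?Q")
    unfolding dual_frame_def
  proof (rule the_equality)
    show "\<exists>b1 b2 b3 f1 f2 f3. adapted_basis UNIV ?R b1 b2 b3 \<and> dual_basis3 b1 b2 b3 f1 f2 f3 \<and>
        ?Q = (dual.pt f1, dual.pt f2, dual.pt f3, dual.pt (f1 + f2 + f3))"
      using assms f unfolding adapted_basis_def by blast
  next
    fix Q assume "\<exists>b1 b2 b3 f1 f2 f3. adapted_basis UNIV ?R b1 b2 b3 \<and> dual_basis3 b1 b2 b3 f1 f2 f3 \<and>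
        Q = (dual.pt f1, dual.pt f2, dual.pt f3, dual.pt (f1 + f2 + f3))"
    then obtain c1 c2 c3 g1 g2 g3 where c: "adapted_basis UNIV ?R c1 c2 c3"
      and g: "dual_basis3 c1 c2 c3 g1 g2 g3"
      and Q: "Q = (dual.pt g1, dual.pt g2, dual.pt g3, dual.pt (g1 + g2 + g3))" by blast
    from c have cb: "is_basis3 UNIV c1 c2 c3"
      and "pt b1 = pt c1" "pt b2 = pt c2" "pt b3 = pt c3" "pt (b1 + b2 + b3) = pt (c1 + c2 + c3)"
      by (auto simp: adapted_basis_def)
    then obtain s1 s2 s3 s where s: "s \<noteq> 0" "c1 = scale s1 b1" "c2 = scale s2 b2" "c3 = scale s3 b3"
      "c1 + c2 + c3 = scale s (b1 + b2 + b3)"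
      using nz by (auto simp: pt_eq_pt_iff)
    then have "comb3 b1 b2 b3 s1 s2 s3 = comb3 b1 b2 b3 s s s"
      by (simp add: comb3_def algebra_simps)
    then have ss: "s1 = s" "s2 = s" "s3 = s" using basis3_comb3_eq_iff[OF assms] by auto
    have eq: "g = dual_scale (inverse s) h"
      if "linear_form g" "linear_form h" "g c1 = h b1" "g c2 = h b2" "g c3 = h b3" for g h
    proof (rule linear_form_eqI[OF assms])
      show "linear_form g" "linear_form (dual_scale (inverse s) h)"
        using that linear_form_scale by auto
      have *: "b = scale (inverse s) (scale s b)" for b using s(1) by simp
      have "g b1 = inverse s * h b1" "g b2 = inverse s * h b2" "g b3 = inverse s * h b3"
        using that s(2-4) ss by (metis * linear_form_iff)+
      then show "g b1 = dual_scale (inverse s) h b1" "g b2 = dual_scale (inverse s) h b2"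
        "g b3 = dual_scale (inverse s) h b3"
        by (simp_all add: dual_scale_def)
    qed
    have "g1 = dual_scale (inverse s) f1" "g2 = dual_scale (inverse s) f2" "g3 = dual_scale (inverse s) f3"
      by (rule eq; use f g in \<open>simp add: dual_basis3_def\<close>)+
    moreover from this have "g1 + g2 + g3 = dual_scale (inverse s) (f1 + f2 + f3)"
      by (simp add: dual.scale_right_distrib)
    ultimately show "Q = ?Q"
      unfolding Q using s(1) by (simp add: dual.pt_scale)
  qed
  then show ?thesis
    using kernel_line_sum_dual_basis[OF assms f] by (simp add: frame_polar_def dual_point_dual_pt)
qed

text \<open>A form is determined by its kernel and by its value at one vector outside.\<close>

lemma kernel_line_eqD:
  assumes "linear_form f" "linear_form g" "g \<noteq> 0" "kernel_line f = kernel_line g"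
  obtains c where "c \<noteq> 0" "g = dual_scale c f"
proof -
  have ker: "f v = 0 \<longleftrightarrow> g v = 0" for v
    using assms(4) Proj_eq_iff[OF subspace_kernel_form subspace_kernel_form] assms(1,2)
    unfolding kernel_line_def by blast
  obtain v where v: "g v \<noteq> 0" using assms(3) by (auto simp: fun_eq_iff)
  then have fv: "f v \<noteq> 0" using ker by blast
  have "g w = (g v / f v) * f w" for w
  proof -
    have lin: "h (w - scale c v) = h w - c * h v" if "linear_form h" for h c
    proof -
      have "h (w - scale c v + scale c v) = h (w - scale c v) + c * h v"
        using that by (metis linear_form_iff)
      then show ?thesis by simp
    qed
    have "f (w - scale (f w / f v) v) = 0"
      using fv by (simp add: lin[OF assms(1)])
    then have "g (w - scale (f w / f v) v) = 0" using ker by blast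
    then show ?thesis by (simp add: lin[OF assms(2)])
  qed
  then have "g = dual_scale (g v / f v) f" unfolding dual_scale_def by (rule ext)
  then show ?thesis using that v fv by (metis divide_eq_0_iff)
qed

lemma kernel_line_dual_scale: "c \<noteq> 0 \<Longrightarrow> kernel_line (dual_scale c f) = kernel_line f"
  by (simp add: kernel_line_def dual_scale_def)

lemma dual_basis3_rotate: "dual_basis3 b1 b2 b3 f1 f2 f3 \<Longrightarrow> dual_basis3 b2 b3 b1 f2 f3 f1"
  by (auto simp: dual_basis3_def)

lemma kernel_line_dual_basis:
  assumes "is_basis3 UNIV b1 b2 b3" "dual_basis3 b1 b2 b3 f1 f2 f3"
  shows "kernel_line f1 = proj_join (pt b2) (pt b3)"
proof -
  have "f1 v = 0 \<longleftrightarrow> v \<in> span {b2, b3}" for v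
  proof -
    obtain x y z where v: "v = comb3 b1 b2 b3 x y z" using basis3_obtain[OF assms(1)] by blast
    have "v \<in> span {b2, b3} \<longleftrightarrow> (\<exists>s t. comb3 b1 b2 b3 x y z = comb3 b1 b2 b3 0 s t)"
      unfolding span2 v by (simp add: comb3_def)
    then show ?thesis
      unfolding basis3_comb3_eq_iff[OF assms(1)] by (simp add: v dual_basis3_comb3[OF assms(2)])
  qed
  then show ?thesis by (simp add: kernel_line_def proj_join_pt)
qed

end

section \<open>The cubic polar\<close>

context proj_space
begin

lemma side_form_iff:
  assumes "is_basis3 UNIV b1 b2 b3" "dual_basis3 b1 b2 b3 f1 f2 f3"
  shows "side_form (pt b2) (pt b3) l \<longleftrightarrow> (\<exists>c. c \<noteq> 0 \<and> l = dual_scale c f1)"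
proof
  have f1: "linear_form f1" "f1 b1 = 1" using assms(2) by (auto simp: dual_basis3_def)
  {
    assume "side_form (pt b2) (pt b3) l"
    then show "\<exists>c. c \<noteq> 0 \<and> l = dual_scale c f1"
      using kernel_line_eqD[of f1 l] f1 kernel_line_dual_basis[OF assms]
      unfolding side_form_def by metis
  next
    assume "\<exists>c. c \<noteq> 0 \<and> l = dual_scale c f1"
    then obtain c where c: "c \<noteq> 0" "l = dual_scale c f1" by blast
    then have "l b1 \<noteq> 0" using f1 by (simp add: dual_scale_def)
    then have "l \<noteq> 0" by auto
    then show "side_form (pt b2) (pt b3) l"
      using c f1 kernel_line_dual_basis[OF assms]
      by (simp add: side_form_def kernel_line_dual_scale linear_form_scale)
  }
qed

text \<open>Polarization by inclusion and exclusion: it recovers the trilinear form from its diagonal as soon as 6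
  is invertible, and so gives uniqueness of the polar form.\<close>

lemma symmetric_trilinear_polarization:
  assumes "symmetric_trilinear \<psi>"
  shows "6 * \<psi> u v w =
    \<psi> (u + v + w) (u + v + w) (u + v + w)
    - \<psi> (u + v) (u + v) (u + v) - \<psi> (u + w) (u + w) (u + w) - \<psi> (v + w) (v + w) (v + w)
    + \<psi> u u u + \<psi> v v v + \<psi> w w w"
proof -
  have add: "\<psi> (a + b) c d = \<psi> a c d + \<psi> b c d" "\<psi> c (a + b) d = \<psi> c a d + \<psi> c b d"
      "\<psi> c d (a + b) = \<psi> c d a + \<psi> c d b" for a b c d
    using assms by (auto simp: symmetric_trilinear_def linear_form_iff)
  have sym: "\<psi> a b c = \<psi> b a c" "\<psi> a b c = \<psi> a c b" for a b c
    using assms unfolding symmetric_trilinear_def by blast+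
  have perm: "\<psi> u w v = \<psi> u v w" "\<psi> v u w = \<psi> u v w" "\<psi> v w u = \<psi> u v w"
      "\<psi> w u v = \<psi> u v w" "\<psi> w v u = \<psi> u v w"
    "\<psi> v u u = \<psi> u u v" "\<psi> u v u = \<psi> u u v"
    "\<psi> w u u = \<psi> u u w" "\<psi> u w u = \<psi> u u w"
    "\<psi> v v u = \<psi> u v v" "\<psi> v u v = \<psi> u v v"
    "\<psi> w v v = \<psi> v v w" "\<psi> v w v = \<psi> v v w"
    "\<psi> w w u = \<psi> u w w" "\<psi> w u w = \<psi> u w w"
    "\<psi> w w v = \<psi> v w w" "\<psi> w v w = \<psi> v w w"
    by (metis sym)+
  show ?thesis by (simp add: add perm)
qed

lemma symmetric_trilinear_eqI:
  assumes "symmetric_trilinear \<psi>" "symmetric_trilinear \<phi>" "\<And>u. \<psi> u u u = \<phi> u u u" "(6 :: 'a) \<noteq> 0"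
  shows "\<psi> = \<phi>"
proof (intro ext)
  fix u v w
  have "6 * \<psi> u v w = 6 * \<phi> u v w"
    unfolding symmetric_trilinear_polarization[OF assms(1)]
      symmetric_trilinear_polarization[OF assms(2)] assms(3) ..
  then show "\<psi> u v w = \<phi> u v w" using assms(4) by simp
qed

text \<open>The polar form of a product is the average over the six ways of distributing the arguments among the
  factors.\<close>

lemma polar_form_product:
  assumes "linear_form f" "linear_form g" "linear_form h" "(6 :: 'a) \<noteq> 0"
  shows "polar_form (\<lambda>x. f x * g x * h x) =
    (\<lambda>u v w. (f u * g v * h w + f u * g w * h v + f v * g u * h w
            + f v * g w * h u + f w * g u * h v + f w * g v * h u) / 6)" (is "_ = ?\<psi>")
proof -
  have sym: "symmetric_trilinear ?\<psi>"
    using assms(1-3) unfolding symmetric_trilinear_def linear_form_iff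
    by (auto simp: algebra_simps add_divide_distrib)
  have diag: "?\<psi> u u u = f u * g u * h u" for u
  proof -
    have "?\<psi> u u u = (6 * (f u * g u * h u)) / 6" by (simp add: algebra_simps)
    also have "\<dots> = f u * g u * h u" using assms(4) by (rule nonzero_mult_div_cancel_left)
    finally show ?thesis .
  qed
  show ?thesis
    unfolding polar_form_def
  proof (rule the_equality)
    show "symmetric_trilinear ?\<psi> \<and> (\<forall>u. ?\<psi> u u u = f u * g u * h u)"
      using sym diag by blast
    fix \<phi> assume "symmetric_trilinear \<phi> \<and> (\<forall>u. \<phi> u u u = f u * g u * h u)"
    then show "\<phi> = ?\<psi>"
      by (intro symmetric_trilinear_eqI[OF _ sym _ assms(4)]) (simp_all only: diag)
  qed
qed

text \<open>The forms \<open>f1, f2, f3\<close> all take the value \<open>k\<close> at \<open>k (b1 + b2 + b3)\<close>, so each of them contributes its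
  value at \<open>v\<close> with the same weight: two of the six terms, that is one third.\<close>

lemma polar_form_dual_basis:
  assumes "is_basis3 UNIV b1 b2 b3" "dual_basis3 b1 b2 b3 f1 f2 f3" "(6 :: 'a) \<noteq> 0"
  shows "polar_form (\<lambda>x. dual_scale a f1 x * dual_scale b f2 x * dual_scale c f3 x)
      (scale k (b1 + b2 + b3)) (scale k (b1 + b2 + b3)) v =
    a * b * c * k ^ 2 / 3 * (f1 + f2 + f3) v"
proof -
  define u where "u = scale k (b1 + b2 + b3)"
  have "u = comb3 b1 b2 b3 k k k" by (simp add: u_def comb3_def algebra_simps)
  then have u: "f1 u = k" "f2 u = k" "f3 u = k"
    using dual_basis3_comb3[OF assms(2)] by auto
  have lin: "linear_form f1" "linear_form f2" "linear_form f3"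
    using assms(2) by (auto simp: dual_basis3_def)
  have nz: "(2 :: 'a) \<noteq> 0" "(3 :: 'a) \<noteq> 0"
    using assms(3) by (metis mult_zero_left mult_zero_right numeral_times_numeral semiring_norm(11,12,13,14))+
  have "polar_form (\<lambda>x. dual_scale a f1 x * dual_scale b f2 x * dual_scale c f3 x) u u v =
    (2 * (a * b * c * k ^ 2 * (f1 v + f2 v + f3 v))) / 6"
    unfolding polar_form_product[OF lin(1)[THEN linear_form_scale] lin(2)[THEN linear_form_scale]
      lin(3)[THEN linear_form_scale] assms(3)]
    by (simp add: dual_scale_def u power2_eq_square algebra_simps)
  also have "\<dots> = a * b * c * k ^ 2 / 3 * (f1 + f2 + f3) v"
    using nz assms(3) by (simp add: field_simps)
  finally show ?thesis unfolding u_def .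
qed

lemma cubic_polar_eq:
  assumes "is_basis3 UNIV b1 b2 b3" "(6 :: 'a) \<noteq> 0"
  shows "cubic_polar (pt b1) (pt b2) (pt b3) (pt (b1 + b2 + b3)) = Proj (zero_sum_plane b1 b2 b3)"
proof -
  obtain f1 f2 f3 where f: "dual_basis3 b1 b2 b3 f1 f2 f3"
    using dual_basis3_exists[OF assms(1)] by blast
  note b231 = basis3_rotate[OF assms(1)] and f231 = dual_basis3_rotate[OF f]
  note b312 = basis3_rotate[OF b231] and f312 = dual_basis3_rotate[OF f231]
  have comm: "side_form (pt b1) (pt b3) = side_form (pt b3) (pt b1)"
    by (intro ext) (simp add: side_form_def proj_join_pt insert_commute)
  note side = side_form_iff[OF assms(1) f] side_form_iff[OF b231 f231, folded comm] side_form_iff[OF b312 f312]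
  have nz: "(3 :: 'a) \<noteq> 0" using assms(2) by (metis mult_zero_left mult_zero_right numeral_times_numeral semiring_norm(11,12,13,14))
  have bnz: "b1 + b2 + b3 \<noteq> 0"
    using basis3_comb3_eq_0_iff[OF assms(1), of 1 1 1] by (simp add: comb3_def)
  have ker: "Proj {v. polar_form (\<lambda>x. l1 x * l2 x * l3 x) u u v = 0} = Proj (zero_sum_plane b1 b2 b3)"
    if l: "side_form (pt b2) (pt b3) l1" "side_form (pt b1) (pt b3) l2" "side_form (pt b1) (pt b2) l3"
      and u: "u \<noteq> 0" "pt (b1 + b2 + b3) = pt u" for l1 l2 l3 u
  proof -
    obtain a b c where abc: "a \<noteq> 0" "b \<noteq> 0" "c \<noteq> 0"
      "l1 = dual_scale a f1" "l2 = dual_scale b f2" "l3 = dual_scale c f3"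
      using l unfolding side by blast
    obtain k where k: "k \<noteq> 0" "u = scale k (b1 + b2 + b3)"
      using u bnz pt_eq_pt_iff by blast
    have "{v. polar_form (\<lambda>x. l1 x * l2 x * l3 x) u u v = 0} = {v. (f1 + f2 + f3) v = 0}"
      unfolding abc k polar_form_dual_basis[OF assms(1) f assms(2)] using abc(1-3) k(1) nz by simp
    then show ?thesis
      using kernel_line_sum_dual_basis[OF assms(1) f] by (simp add: kernel_line_def)
  qed
  have forms: "side_form (pt b2) (pt b3) f1" "side_form (pt b1) (pt b3) f2" "side_form (pt b1) (pt b2) f3"
    unfolding side by (metis dual.scale_one zero_neq_one)+
  show ?thesis
    unfolding cubic_polar_def
  proof (rule the_equality)
    show "\<exists>l1 l2 l3 u. side_form (pt b2) (pt b3) l1 \<and> side_form (pt b1) (pt b3) l2 \<and>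
        side_form (pt b1) (pt b2) l3 \<and> u \<noteq> 0 \<and> pt (b1 + b2 + b3) = pt u \<and>
        Proj (zero_sum_plane b1 b2 b3) = Proj {v. polar_form (\<lambda>x. l1 x * l2 x * l3 x) u u v = 0}"
      by (intro exI conjI, rule forms(1), rule forms(2), rule forms(3), rule bnz, rule refl,
          rule ker[OF forms bnz refl, symmetric])
  next
    fix L assume "\<exists>l1 l2 l3 u. side_form (pt b2) (pt b3) l1 \<and> side_form (pt b1) (pt b3) l2 \<and>
        side_form (pt b1) (pt b2) l3 \<and> u \<noteq> 0 \<and> pt (b1 + b2 + b3) = pt u \<and>
        L = Proj {v. polar_form (\<lambda>x. l1 x * l2 x * l3 x) u u v = 0}"
    then show "L = Proj (zero_sum_plane b1 b2 b3)" by (elim exE conjE) (erule trans, rule ker; assumption)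
  qed
qed

end

lemma six_neq_0:
  assumes "CHAR('a::field) \<noteq> 2" "CHAR('a) \<noteq> 3"
  shows "(6 :: 'a) \<noteq> 0"
proof -
  have "d = 1 \<or> d = 2" if "d dvd 2" for d :: nat
    using that dvd_imp_le[OF that] by (cases "d = 0") auto
  moreover have "d = 1 \<or> d = 2 \<or> d = 3" if "d dvd 3" for d :: nat
    using that dvd_imp_le[OF that] by (cases "d = 0") auto
  ultimately have "\<not> CHAR('a) dvd 2" "\<not> CHAR('a) dvd 3"
    using assms CHAR_not_1[where 'a = 'a] by fastforce+
  then have "(2 :: 'a) \<noteq> 0" "(3 :: 'a) \<noteq> 0"
    using of_nat_eq_0_iff_char_dvd[where 'a = 'a, of 2] of_nat_eq_0_iff_char_dvd[where 'a = 'a, of 3] by auto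
  moreover have "(6 :: 'a) = 2 * 3" by simp
  ultimately show ?thesis by (metis mult_eq_0_iff)
qed

section \<open>The center of gravity of a plane triangle\<close>

lemma set_integrable_id_bounded:
  fixes S :: "'a::euclidean_space set"
  assumes "bounded S" "S \<in> sets borel"
  shows "set_integrable lborel S (\<lambda>x. x)"
proof (rule set_integrable_subset)
  show "set_integrable lborel (closure S) (\<lambda>x. x)"
    unfolding set_integrable_def using assms(1)
    by (intro borel_integrable_compact) (auto intro: continuous_intros)
qed (use assms closure_subset in auto)

text \<open>Guarantees that the division in the definition of the center of gravity is a genuine one.\<close>

lemma measure_lborel_open_pos:
  fixes S :: "'a::euclidean_space set"
  assumes "open S" "bounded S" "S \<noteq> {}"
  shows "measure lborel S > 0"
proof -
  have "S \<in> lmeasurable" using assms by (simp add: lmeasurable_open)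
  moreover have "\<not> negligible S" using assms open_not_negligible by blast
  ultimately have "measure lebesgue S \<noteq> 0" using negligible_iff_measure by blast
  then show ?thesis
    using assms(1) by (simp add: measure_completion zero_less_measure_iff)
qed

text \<open>Change of variables: the map preserves \<open>S\<close> and volume, so it preserves the integral of the identity over
  \<open>S\<close>; being affine, it acts on that integral as on a point weighted by the measure of \<open>S\<close>.\<close>

lemma center_of_gravity_affine_invariant:
  fixes S :: "(real^2) set" and h :: "real^2 \<Rightarrow> real^2"
  assumes S: "open S" "bounded S" "S \<noteq> {}"
    and h: "linear h" "\<bar>det (matrix h)\<bar> = 1"
    and inv: "(\<lambda>x. h x + d) ` S = S"
  shows "h (center_of_gravity S) + d = center_of_gravity S"
proof -
  define I where "I = integral S (\<lambda>x. x)"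
  define m where "m = measure lborel S"
  have m: "m > 0" unfolding m_def by (rule measure_lborel_open_pos[OF S])
  have Sb: "S \<in> sets borel" using S by simp
  have int: "set_integrable lborel S (\<lambda>x. x)"
    by (rule set_integrable_id_bounded[OF S(2) Sb])
  have cog: "center_of_gravity S = (1 / m) *\<^sub>R I"
    unfolding center_of_gravity_def I_def m_def set_borel_integral_eq_integral(2)[OF int] ..
  have abs: "(\<lambda>x. x) absolutely_integrable_on S"
    using int Sb by (simp add: set_integrable_def integrable_completion)
  have "inj h"
    using h det_nz_iff_inj by fastforce
  then have "inj_on (\<lambda>x. h x + d) S" by (auto simp: inj_on_def)
  moreover have "((\<lambda>x. h x + d) has_derivative h) (at x within S)" for x
    using h(1) by (auto intro!: derivative_eq_intros linear_imp_has_derivative)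
  ultimately have "(\<lambda>x. \<bar>det (matrix h)\<bar> *\<^sub>R (h x + d)) absolutely_integrable_on S \<and>
      integral S (\<lambda>x. \<bar>det (matrix h)\<bar> *\<^sub>R (h x + d)) = I"
    using has_absolute_integral_change_of_variables[of S "\<lambda>x. h x + d" "\<lambda>x. h" "\<lambda>x. x" I] abs Sb
    unfolding inv I_def by simp
  then have "I = integral S (\<lambda>x. h x + d)" using h(2) by simp
  also have "\<dots> = h I + m *\<^sub>R d"
  proof -
    have 1: "(\<lambda>x. x) integrable_on S" using abs by (rule set_lebesgue_integral_eq_integral(1))
    have bl: "bounded_linear h" using h(1) by (simp add: linear_linear)
    have 2: "h \<circ> (\<lambda>x. x) integrable_on S" "integral S (h \<circ> (\<lambda>x. x)) = h I"
      unfolding I_def using integrable_linear[OF 1 bl] integral_linear[OF 1 bl] by auto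
    have "((\<lambda>x. 1 :: real) has_integral m) S"
      unfolding m_def using Sb emeasure_bounded_finite[OF S(2)]
      by (intro has_integral_measure_lborel) simp_all
    then have 3: "((\<lambda>x. d) has_integral m *\<^sub>R d) S"
      using has_integral_scaleR_left[of "\<lambda>x. 1 :: real" m S d] by simp
    show ?thesis
      using has_integral_add[OF integrable_integral[OF 2(1)] 3] 2(2)
      by (simp add: o_def integral_unique)
  qed
  finally have "I = h I + m *\<^sub>R d" .
  then have "(1 / m) *\<^sub>R I = (1 / m) *\<^sub>R h I + (1 / m) *\<^sub>R m *\<^sub>R d"
    by (metis scaleR_right_distrib)
  moreover have "h ((1 / m) *\<^sub>R I) = (1 / m) *\<^sub>R h I" by (rule linear_cmul[OF h(1)])
  ultimately show ?thesis unfolding cog using m by simp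
qed

text \<open>The components of \<open>aff\<close> are barycentric coordinates on the affine plane, and \<open>S\<close> is the open triangle
  on which they are positive. The affine map \<open>x \<mapsto> h x + d\<close> constructed in the proof permutes the three
  coordinates cyclically. It therefore preserves \<open>S\<close>, and it has determinant 1, since its linear part
  is conjugate to the map of order three \<open>(p, q) \<mapsto> (q, - p - q)\<close>. As it fixes the center of gravity, the
  coordinates of the latter are equal.\<close>

lemma center_of_gravity_triangle:
  fixes a b c :: "real^3"
  assumes sums: "a $ 1 + a $ 2 + a $ 3 = 0" "b $ 1 + b $ 2 + b $ 3 = 0" "c $ 1 + c $ 2 + c $ 3 = 1"
    and inj: "\<And>s t. s *\<^sub>R a + t *\<^sub>R b = 0 \<Longrightarrow> s = 0 \<and> t = 0"
  defines "aff \<equiv> \<lambda>x :: real^2. (x $ 1) *\<^sub>R a + (x $ 2) *\<^sub>R b + c"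
  defines "S \<equiv> {x. aff x $ 1 > 0 \<and> aff x $ 2 > 0 \<and> aff x $ 3 > 0}"
  shows "aff (center_of_gravity S) $ i = 1 / 3"
proof -
  define D where "D = a $ 1 * b $ 2 - a $ 2 * b $ 1"
  have a3: "a $ 3 = - a $ 1 - a $ 2" and b3: "b $ 3 = - b $ 1 - b $ 2" and c3: "c $ 3 = 1 - c $ 1 - c $ 2"
    using sums by auto
  have D: "D \<noteq> 0"
  proof
    assume D0: "D = 0"
    have "(b $ 1) *\<^sub>R a + (- a $ 1) *\<^sub>R b = 0" "(b $ 2) *\<^sub>R a + (- a $ 2) *\<^sub>R b = 0"
      using D0 by (auto simp: vec_eq_iff forall_3 a3 b3 D_def algebra_simps)
    then have "a $ 1 = 0" "b $ 1 = 0" "a $ 2 = 0" "b $ 2 = 0" using inj by fastforce+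
    then have "1 *\<^sub>R a + 0 *\<^sub>R b = 0" by (simp add: vec_eq_iff forall_3 a3)
    then show False using inj by fastforce
  qed
  have aff_sum: "aff x $ 1 + aff x $ 2 + aff x $ 3 = 1" for x
    by (simp add: aff_def a3 b3 c3 algebra_simps)
  have aff_inj: "x = y" if "aff x $ 1 = aff y $ 1" "aff x $ 2 = aff y $ 2" for x y
  proof -
    have "(x $ 1 - y $ 1) *\<^sub>R a + (x $ 2 - y $ 2) *\<^sub>R b = 0"
      using that by (simp add: vec_eq_iff forall_3 aff_def a3 b3 algebra_simps)
    then have "x $ 1 - y $ 1 = 0 \<and> x $ 2 - y $ 2 = 0" by (rule inj)
    then show ?thesis by (simp add: vec_eq_iff forall_2)
  qed
  define E :: "real \<Rightarrow> real \<Rightarrow> real^2" where "E s t = s *\<^sub>R axis 1 1 + t *\<^sub>R axis 2 1" for s t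
  have E: "E s t $ 1 = s" "E s t $ 2 = t" for s t by (simp_all add: E_def axis_def)
  \<comment> \<open>Cramer's rule for the linear part of the first two coordinates; \<open>G\<close> inverts the affine map itself.\<close>
  define B :: "real \<Rightarrow> real \<Rightarrow> real^2" where
    "B p q = E ((p * b $ 2 - q * b $ 1) / D) ((a $ 1 * q - a $ 2 * p) / D)" for p q
  define G where "G p q = B (p - c $ 1) (q - c $ 2)" for p q
  have affG: "aff (G p q) $ 1 = p" "aff (G p q) $ 2 = q" for p q
    using D by (simp_all add: aff_def G_def B_def E divide_simps) (simp_all add: D_def algebra_simps)
  have Gaff: "G (aff x $ 1) (aff x $ 2) = x" for x by (intro aff_inj) (simp_all add: affG)
  define h where "h x = B (x $ 1 * a $ 2 + x $ 2 * b $ 2) (x $ 1 * a $ 3 + x $ 2 * b $ 3)" for x :: "real^2"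
  define d where "d = B (c $ 2 - c $ 1) (c $ 3 - c $ 2)"
  have T: "h x + d = G (aff x $ 2) (aff x $ 3)" for x
    by (simp add: vec_eq_iff forall_2 h_def d_def G_def B_def E aff_def add_divide_distrib[symmetric] algebra_simps)
  have affT: "aff (h x + d) $ 1 = aff x $ 2" "aff (h x + d) $ 2 = aff x $ 3" "aff (h x + d) $ 3 = aff x $ 1" for x
    using aff_sum[of x] aff_sum[of "h x + d"] unfolding T affG by linarith+
  have h: "linear h"
    by (rule linearI) (simp_all add: vec_eq_iff forall_2 h_def B_def E add_divide_distrib[symmetric] algebra_simps)
  have det: "det (matrix h) = 1"
    using D by (simp add: det_2 matrix_def h_def B_def E axis_def a3 b3 divide_simps)
      (simp add: D_def algebra_simps)
  have open_S: "open S"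
    unfolding S_def aff_def
    by (intro open_Collect_conj open_Collect_less continuous_intros)
  have bdd: "bounded S"
  proof (rule bounded_subset)
    show "S \<subseteq> (\<lambda>p :: real^2. G (p $ 1) (p $ 2)) ` cbox 0 1"
    proof
      fix x assume "x \<in> S"
      then have "E (aff x $ 1) (aff x $ 2) \<in> cbox 0 1"
        using aff_sum[of x] by (auto simp: S_def mem_box_cart forall_2 E)
      then show "x \<in> (\<lambda>p :: real^2. G (p $ 1) (p $ 2)) ` cbox 0 1"
        by (rule rev_image_eqI) (simp add: E Gaff)
    qed
    show "bounded ((\<lambda>p :: real^2. G (p $ 1) (p $ 2)) ` cbox 0 1)"
      unfolding G_def B_def E_def
      by (intro compact_imp_bounded compact_continuous_image compact_cbox continuous_intros ballI D)
  qed
  have ne: "S \<noteq> {}"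
  proof -
    have "G (1/3) (1/3) \<in> S" using aff_sum[of "G (1/3) (1/3)"] by (simp add: S_def affG)
    then show ?thesis by blast
  qed
  have inv: "(\<lambda>x. h x + d) ` S = S"
  proof (rule antisym; rule subsetI)
    fix y assume "y \<in> (\<lambda>x. h x + d) ` S"
    then show "y \<in> S" by (auto simp: S_def affT)
  next
    fix y assume "y \<in> S"
    \<comment> \<open>The cyclic permutation has order three, so its square is its inverse.\<close>
    let ?x = "h (h y + d) + d"
    have "?x \<in> S" using \<open>y \<in> S\<close> by (auto simp: S_def affT)
    moreover have "y = h ?x + d" by (intro aff_inj) (simp_all only: affT)
    ultimately show "y \<in> (\<lambda>x. h x + d) ` S" by blast
  qed
  have fixed: "h (center_of_gravity S) + d = center_of_gravity S"
    by (rule center_of_gravity_affine_invariant[OF open_S bdd ne h _ inv]) (simp add: det)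
  have "aff (center_of_gravity S) $ 1 = aff (center_of_gravity S) $ 2"
    "aff (center_of_gravity S) $ 2 = aff (center_of_gravity S) $ 3"
    using affT[of "center_of_gravity S"] unfolding fixed by auto
  with aff_sum[of "center_of_gravity S"] show ?thesis
    using exhaust_3[of i] by auto
qed

section \<open>Projective lines as kernels of linear forms\<close>

context proj_space
begin

text \<open>A basis whose first two vectors span the zero-sum plane. It shows that \<open>x + y + z = 0\<close> is a line, and it
  provides an affine chart sending this line to infinity.\<close>

lemma zero_sum_basis:
  assumes "is_basis3 W b1 b2 b3"
  shows "is_basis3 W (b1 - b3) (b2 - b3) b3"
proof -
  have 1: "comb3 (b1 - b3) (b2 - b3) b3 x y z = comb3 b1 b2 b3 x y (z - x - y)" for x y z
    by (simp add: comb3_def algebra_simps)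
  have 2: "comb3 b1 b2 b3 x y z = comb3 (b1 - b3) (b2 - b3) b3 x y (z + x + y)" for x y z
    by (simp add: 1)
  have "W = {v. \<exists>x y z. v = comb3 (b1 - b3) (b2 - b3) b3 x y z}"
  proof (intro set_eqI iffI; clarify)
    fix v assume "v \<in> W"
    then obtain x y z where "v = comb3 b1 b2 b3 x y z" using basis3_obtain[OF assms(1)] by blast
    then show "\<exists>x y z. v = comb3 (b1 - b3) (b2 - b3) b3 x y z"
      unfolding 2 by blast
  next
    fix x y z show "comb3 (b1 - b3) (b2 - b3) b3 x y z \<in> W"
      unfolding 1 by (rule basis3_comb3_mem[OF assms(1)])
  qed
  then show ?thesis
    unfolding is_basis3_iff by (auto simp: 1 basis3_comb3_eq_0_iff[OF assms])
qed

lemma zero_sum_plane_span: "zero_sum_plane b1 b2 b3 = span {b1 - b3, b2 - b3}"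
proof (intro set_eqI iffI)
  fix v assume "v \<in> zero_sum_plane b1 b2 b3"
  then obtain x y z where v: "v = comb3 b1 b2 b3 x y z" and "x + y + z = 0"
    by (auto simp: zero_sum_plane_def)
  then have z: "z = - x - y" by (simp add: algebra_simps eq_neg_iff_add_eq_0)
  have "v = scale x (b1 - b3) + scale y (b2 - b3)"
    unfolding v z by (simp add: comb3_def algebra_simps)
  then show "v \<in> span {b1 - b3, b2 - b3}" unfolding span2 by blast
next
  fix v assume "v \<in> span {b1 - b3, b2 - b3}"
  then obtain x y where "v = scale x (b1 - b3) + scale y (b2 - b3)" unfolding span2 by blast
  then have "v = comb3 b1 b2 b3 x y (- x - y)" by (simp add: comb3_def algebra_simps)
  then show "v \<in> zero_sum_plane b1 b2 b3"
    unfolding zero_sum_plane_def mem_Collect_eq by (intro exI conjI, assumption) simp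
qed

lemma subspace_zero_sum_plane: "subspace (zero_sum_plane b1 b2 b3)"
  by (simp add: zero_sum_plane_span)

lemma comb3_mem_zero_sum_plane:
  assumes "is_basis3 W b1 b2 b3"
  shows "comb3 b1 b2 b3 x y z \<in> zero_sum_plane b1 b2 b3 \<longleftrightarrow> x + y + z = 0"
  unfolding zero_sum_plane_def mem_Collect_eq basis3_comb3_eq_iff[OF assms] by auto

lemma proj_line_basis:
  assumes "is_basis3 W b1 b2 b3"
  shows "proj_line W (Proj (span {b1, b2}))"
proof -
  have b: "b1 \<noteq> b2" "independent {b1, b2, b3}" "W = span {b1, b2, b3}"
    using assms by (auto simp: is_basis3_def)
  have "independent {b1, b2}" using b(2) by (rule independent_mono) auto
  then have "dim (span {b1, b2}) = 2" using b(1) by (simp add: dim_eq_card_independent)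
  moreover have "span {b1, b2} \<subseteq> W" unfolding b(3) by (rule span_mono) auto
  ultimately show ?thesis unfolding proj_line_def by blast
qed

text \<open>Complete a basis of the plane by a vector outside it and take the coordinate along that vector.\<close>

lemma proj_line_obtain_form:
  assumes "is_basis3 UNIV b1 b2 b3" "proj_line UNIV L"
  obtains f where "linear_form f" "f \<noteq> 0" "L = kernel_line f"
proof -
  obtain S where S: "subspace S" "dim S = 2" "L = Proj S"
    using assms(2) by (auto simp: proj_line_def)
  obtain B where B: "B \<subseteq> S" "independent B" "S \<subseteq> span B" "card B = 2"
    using basis_exists[of S] S(2) by metis
  then obtain e1 e2 where e: "B = {e1, e2}" "e1 \<noteq> e2" by (auto simp: card_2_iff)
  have spS: "span {e1, e2} = S" using B S(1) span_minimal unfolding e by blast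
  have dimU: "dim UNIV = 3" by (rule basis3_dim[OF assms(1)])
  then have "S \<noteq> UNIV" using S(2) by auto
  then obtain e3 where e3: "e3 \<notin> S" by blast
  have ind: "independent {e3, e1, e2}"
    using B(2) e3 spS independent_insertI[of e3 "{e1, e2}"] unfolding e by simp
  have dist: "e3 \<noteq> e1" "e3 \<noteq> e2" using e3 B(1) e by auto
  have "span {e3, e1, e2} = UNIV"
    using ind dist e(2) by (intro subspace_eq_UNIV[OF dimU]) (auto simp: dim_eq_card_independent)
  then have bas: "is_basis3 UNIV e3 e1 e2"
    using ind dist e(2) by (simp add: is_basis3_def)
  obtain f1 f2 f3 where f: "dual_basis3 e3 e1 e2 f1 f2 f3" using dual_basis3_exists[OF bas] by blast
  have "L = kernel_line f1"
    unfolding kernel_line_dual_basis[OF bas f] proj_join_pt spS S(3) ..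
  moreover have "linear_form f1" "f1 \<noteq> 0" using f by (auto simp: dual_basis3_def)
  ultimately show ?thesis using that by blast
qed

text \<open>Modify the basis so that \<open>f\<close> becomes its first coordinate form: divide \<open>b1\<close> by \<open>f b1\<close> and subtract multiples
  of it from \<open>b2\<close> and \<open>b3\<close>.\<close>

lemma proj_line_kernel_line:
  assumes "is_basis3 UNIV b1 b2 b3" "linear_form f" "f b1 \<noteq> 0"
  shows "proj_line UNIV (kernel_line f)"
proof -
  \<comment> \<open>The basis \<open>(c1, c2, c3)\<close> satisfies \<open>f c1 = 1\<close> and \<open>f c2 = f c3 = 0\<close>.\<close>
  define c1 where "c1 = scale (inverse (f b1)) b1"
  define c2 where "c2 = b2 - scale (f b2) c1"
  define c3 where "c3 = b3 - scale (f b3) c1"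
  have diff: "f (v - w) = f v - f w" for v w
    using assms(2) by (metis add_diff_cancel_right' diff_add_cancel linear_form_iff)
  have c1: "f c1 = 1" using assms(2,3) by (simp add: c1_def linear_form_iff)
  have c: "f c2 = 0" "f c3 = 0"
    using assms(2) c1 by (simp_all add: c2_def c3_def diff linear_form_iff)
  have comb: "comb3 b1 b2 b3 x y z = comb3 c1 c2 c3 (x * f b1 + y * f b2 + z * f b3) y z" for x y z
    using assms(3) by (simp add: comb3_def c1_def c2_def c3_def algebra_simps)
  have comb': "comb3 c1 c2 c3 x y z =
      comb3 b1 b2 b3 (inverse (f b1) * (x - y * f b2 - z * f b3)) y z" for x y z
    using assms(3) by (simp add: comb3_def c1_def c2_def c3_def algebra_simps)
  have bas: "is_basis3 UNIV c1 c2 c3"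
    unfolding is_basis3_iff
  proof (intro conjI set_eqI iffI allI impI UNIV_I)
    fix v
    obtain x y z where "v = comb3 b1 b2 b3 x y z" using basis3_obtain[OF assms(1)] by blast
    then show "v \<in> {v. \<exists>x y z. v = comb3 c1 c2 c3 x y z}" unfolding comb by blast
  next
    fix x y z assume "comb3 c1 c2 c3 x y z = 0"
    then have "inverse (f b1) * (x - y * f b2 - z * f b3) = 0 \<and> y = 0 \<and> z = 0"
      unfolding comb' basis3_comb3_eq_0_iff[OF assms(1)] .
    then show "x = 0" "y = 0" "z = 0" using assms(3) by auto
  qed
  obtain f1 f2 f3 where f: "dual_basis3 c1 c2 c3 f1 f2 f3" using dual_basis3_exists[OF bas] by blast
  have "f1 = f"
    by (rule linear_form_eqI[OF bas]) (use f assms(2) c c1 in \<open>auto simp: dual_basis3_def\<close>)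
  then have "kernel_line f = Proj (span {c2, c3})"
    using kernel_line_dual_basis[OF bas f] by (simp add: proj_join_pt)
  then show ?thesis using proj_line_basis[OF basis3_rotate[OF bas]] by simp
qed

lemma line_dual_kernel_line:
  assumes "linear_form f" "f \<noteq> 0"
  shows "line_dual (kernel_line f) = dual.pt f"
  unfolding line_dual_def
proof (rule the_equality)
  show "\<exists>g. linear_form g \<and> g \<noteq> 0 \<and> kernel_line g = kernel_line f \<and> dual.pt f = dual.pt g"
    using assms by blast
next
  fix q assume "\<exists>g. linear_form g \<and> g \<noteq> 0 \<and> kernel_line g = kernel_line f \<and> q = dual.pt g"
  then obtain g where g: "linear_form g" "g \<noteq> 0" "kernel_line f = kernel_line g" "q = dual.pt g" by metis
  then obtain c where "c \<noteq> 0" "g = dual_scale c f" using kernel_line_eqD[OF assms(1)] by blast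
  then show "q = dual.pt f" using g(4) dual.pt_scale by simp
qed

lemma point_dual_unit_point:
  assumes "is_basis3 UNIV b1 b2 b3" "dual_basis3 b1 b2 b3 f1 f2 f3"
  shows "point_dual (pt (b1 + b2 + b3)) = dual.Proj (dual.zero_sum_plane f1 f2 f3)"
proof -
  have "(f \<in> dual_space \<and> (\<forall>v\<in>pt (b1 + b2 + b3). f v = 0)) \<longleftrightarrow> f \<in> dual.zero_sum_plane f1 f2 f3" for f
  proof (cases "f \<in> dual_space")
    case True
    then have lin: "linear_form f" by (simp add: dual_space_def)
    then have "(\<forall>v\<in>pt (b1 + b2 + b3). f v = 0) \<longleftrightarrow> f b1 + f b2 + f b3 = 0"
      unfolding pt_eq_range by (auto simp: linear_form_iff dest: spec[of _ 1])
    also have "\<dots> \<longleftrightarrow> f \<in> dual.zero_sum_plane f1 f2 f3"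
      using dual.comb3_mem_zero_sum_plane[OF dual_basis3_is_basis3[OF assms]]
        linear_form_dual_expansion[OF assms lin] by metis
    finally show ?thesis using True by simp
  next
    case False
    moreover have "dual.zero_sum_plane f1 f2 f3 \<subseteq> dual_space"
      using dual.basis3_comb3_mem[OF dual_basis3_is_basis3[OF assms]]
      by (auto simp: dual.zero_sum_plane_def)
    ultimately show ?thesis by blast
  qed
  then show ?thesis by (simp add: point_dual_def)
qed

end

section \<open>Open octants in the topology of the projective plane\<close>

lemma convex_positive_orthant: "convex {x :: real^'n. \<forall>i. x $ i > 0}"
proof -
  have "convex {x :: real. 0 < x}"
    using convex_real_interval(3)[of 0] by (simp add: greaterThan_def)
  then show ?thesis by (rule convex_box_cart)
qed

context real_proj_space
begin

text \<open>The linear coordinate map from \<open>\<real>\<^sup>3\<close> through which the topology of the projective plane is defined.\<close>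

definition vcomb :: "'b \<Rightarrow> 'b \<Rightarrow> 'b \<Rightarrow> real^3 \<Rightarrow> 'b" where
  "vcomb b1 b2 b3 x = comb3 b1 b2 b3 (x $ 1) (x $ 2) (x $ 3)"

lemma vcomb_add: "vcomb b1 b2 b3 (x + y) = vcomb b1 b2 b3 x + vcomb b1 b2 b3 y"
  by (simp add: vcomb_def comb3_add)

lemma vcomb_scaleR: "vcomb b1 b2 b3 (c *\<^sub>R x) = scale c (vcomb b1 b2 b3 x)"
  by (simp add: vcomb_def scale_comb3)

lemma comb3_eq_vcomb: "comb3 b1 b2 b3 x y z = vcomb b1 b2 b3 (vector [x, y, z])"
  by (simp add: vcomb_def)

lemma vcomb_mem: "is_basis3 W b1 b2 b3 \<Longrightarrow> vcomb b1 b2 b3 x \<in> W"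
  by (simp add: vcomb_def basis3_comb3_mem)

lemma vcomb_obtain:
  assumes "is_basis3 W b1 b2 b3" "v \<in> W"
  obtains x where "v = vcomb b1 b2 b3 x"
  using basis3_obtain[OF assms] comb3_eq_vcomb by metis

lemma vcomb_eq_iff:
  assumes "is_basis3 W b1 b2 b3"
  shows "vcomb b1 b2 b3 x = vcomb b1 b2 b3 y \<longleftrightarrow> x = y"
  by (simp add: vcomb_def basis3_comb3_eq_iff[OF assms] vec_eq_iff forall_3)

lemma vcomb_eq_0_iff:
  assumes "is_basis3 W b1 b2 b3"
  shows "vcomb b1 b2 b3 x = 0 \<longleftrightarrow> x = 0"
  by (simp add: vcomb_def basis3_comb3_eq_0_iff[OF assms] vec_eq_iff forall_3)

lemma Proj_basis3:
  assumes "is_basis3 W b1 b2 b3"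
  shows "Proj W = {pt (vcomb b1 b2 b3 x) | x. x \<noteq> 0}"
proof (intro set_eqI iffI)
  fix q assume "q \<in> Proj W"
  then obtain v where v: "q = pt v" "v \<in> W" "v \<noteq> 0" by (auto simp: Proj_def)
  then obtain x where "v = vcomb b1 b2 b3 x" using vcomb_obtain[OF assms] by blast
  then show "q \<in> {pt (vcomb b1 b2 b3 x) | x. x \<noteq> 0}"
    using v vcomb_eq_0_iff[OF assms] by auto
next
  fix q assume "q \<in> {pt (vcomb b1 b2 b3 x) | x. x \<noteq> 0}"
  then show "q \<in> Proj W" using vcomb_mem[OF assms] vcomb_eq_0_iff[OF assms] by (auto simp: Proj_def)
qed

lemma pt_vcomb_eq_iff:
  assumes "is_basis3 W b1 b2 b3" "x \<noteq> 0"
  shows "pt (vcomb b1 b2 b3 x) = pt (vcomb b1 b2 b3 y) \<longleftrightarrow> (\<exists>c. c \<noteq> 0 \<and> y = c *\<^sub>R x)"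
  using pt_eq_pt_iff[of "vcomb b1 b2 b3 x"] assms
  by (simp add: vcomb_eq_0_iff vcomb_scaleR[symmetric] vcomb_eq_iff)

text \<open>Openness quantifies over all bases, but a change of basis is a continuous linear automorphism \<open>M\<close> of
  \<open>\<real>\<^sup>3\<close>. It therefore suffices to test a single basis.\<close>

lemma proj_open_iff:
  assumes "is_basis3 W b1 b2 b3"
  shows "proj_open W U \<longleftrightarrow> U \<subseteq> Proj W \<and> open {x. x \<noteq> 0 \<and> pt (vcomb b1 b2 b3 x) \<in> U}"
proof
  assume "proj_open W U"
  then show "U \<subseteq> Proj W \<and> open {x. x \<noteq> 0 \<and> pt (vcomb b1 b2 b3 x) \<in> U}"
    using assms by (simp add: proj_open_def vcomb_def comb3_def)
next
  assume U: "U \<subseteq> Proj W \<and> open {x. x \<noteq> 0 \<and> pt (vcomb b1 b2 b3 x) \<in> U}"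
  show "proj_open W U"
    unfolding proj_open_def
  proof (intro conjI allI impI)
    show "U \<subseteq> Proj W" using U by blast
    fix c1 c2 c3 assume c: "is_basis3 W c1 c2 c3"
    have "c1 \<in> W" "c2 \<in> W" "c3 \<in> W"
      using c by (auto simp: is_basis3_def intro: span_base)
    then obtain m1 m2 m3 where m: "c1 = vcomb b1 b2 b3 m1" "c2 = vcomb b1 b2 b3 m2" "c3 = vcomb b1 b2 b3 m3"
      using vcomb_obtain[OF assms] by metis
    define M where "M x = (x $ 1) *\<^sub>R m1 + (x $ 2) *\<^sub>R m2 + (x $ 3) *\<^sub>R m3" for x :: "real^3"
    have M: "vcomb b1 b2 b3 (M x) = vcomb c1 c2 c3 x" for x
    proof -
      have "vcomb b1 b2 b3 (M x) = scale (x $ 1) c1 + scale (x $ 2) c2 + scale (x $ 3) c3"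
        unfolding M_def vcomb_add vcomb_scaleR m ..
      then show ?thesis by (simp add: vcomb_def comb3_def)
    qed
    have M0: "M x = 0 \<longleftrightarrow> x = 0" for x
      by (metis M vcomb_eq_0_iff[OF assms] vcomb_eq_0_iff[OF c])
    have cont: "continuous_on UNIV M" unfolding M_def by (intro continuous_intros)
    have "{x. x \<noteq> 0 \<and> pt (vcomb c1 c2 c3 x) \<in> U} = M -` {x. x \<noteq> 0 \<and> pt (vcomb b1 b2 b3 x) \<in> U}"
      by (simp add: M M0 vimage_def)
    also have "open \<dots>" using U cont by (intro open_vimage) auto
    finally show "open {x :: real^3. x \<noteq> 0 \<and> pt (scale (x $ 1) c1 + scale (x $ 2) c2 + scale (x $ 3) c3) \<in> U}"
      by (simp add: vcomb_def comb3_def)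
  qed
qed

lemma topspace_proj_topology:
  assumes "is_basis3 W b1 b2 b3"
  shows "topspace (proj_topology W) = Proj W"
proof
  show "topspace (proj_topology W) \<subseteq> Proj W"
    using openin_topspace[of "proj_topology W"]
    unfolding openin_proj_topology proj_open_def by (rule conjunct1)
  have "{x. x \<noteq> 0 \<and> pt (vcomb b1 b2 b3 x) \<in> Proj W} = - {0}"
    using Proj_basis3[OF assms] by auto
  then have "openin (proj_topology W) (Proj W)"
    unfolding openin_proj_topology proj_open_iff[OF assms] by (simp add: open_Compl)
  then show "Proj W \<subseteq> topspace (proj_topology W)" by (rule openin_subset)
qed

lemma continuous_map_pt_vcomb:
  assumes "is_basis3 W b1 b2 b3"
  shows "continuous_map (top_of_set (- {0})) (proj_topology W) (\<lambda>x. pt (vcomb b1 b2 b3 x))"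
  unfolding continuous_map_def
proof (intro conjI allI impI)
  show "(\<lambda>x. pt (vcomb b1 b2 b3 x)) \<in> topspace (top_of_set (- {0})) \<rightarrow> topspace (proj_topology W)"
    using Proj_basis3[OF assms] by (auto simp: topspace_proj_topology[OF assms])
  fix U assume "openin (proj_topology W) U"
  then have "open {x. x \<noteq> 0 \<and> pt (vcomb b1 b2 b3 x) \<in> U}"
    by (simp add: openin_proj_topology proj_open_iff[OF assms])
  moreover have "{x. x \<noteq> 0 \<and> pt (vcomb b1 b2 b3 x) \<in> U} \<subseteq> - {0}" by auto
  moreover have "{x \<in> topspace (top_of_set (- {0})). pt (vcomb b1 b2 b3 x) \<in> U} =
      {x. x \<noteq> 0 \<and> pt (vcomb b1 b2 b3 x) \<in> U}" by auto
  ultimately show "openin (top_of_set (- {0})) {x \<in> topspace (top_of_set (- {0})). pt (vcomb b1 b2 b3 x) \<in> U}"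
    using openin_open_eq[of "- {0 :: real^3}"] by (simp add: open_Compl)
qed

lemma connectedin_pt_vcomb_image:
  assumes "is_basis3 W b1 b2 b3" "connected S" "0 \<notin> S"
  shows "connectedin (proj_topology W) ((\<lambda>x. pt (vcomb b1 b2 b3 x)) ` S)"
proof (rule connectedin_continuous_map_image[OF continuous_map_pt_vcomb[OF assms(1)]])
  show "connectedin (top_of_set (- {0})) S"
    using assms(2,3) by (auto simp: connectedin_subtopology)
qed

text \<open>A class has representatives of both signs, so membership of \<open>pt (vcomb b1 b2 b3 x)\<close> allows three negative
  coordinates as well, see \<open>pt_mem_octant_iff\<close>.\<close>

definition octant :: "'b \<Rightarrow> 'b \<Rightarrow> 'b \<Rightarrow> 'b set set" where
  "octant b1 b2 b3 = {pt (vcomb b1 b2 b3 x) | x. \<forall>i. x $ i > 0}"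

definition closed_octant :: "'b \<Rightarrow> 'b \<Rightarrow> 'b \<Rightarrow> 'b set set" where
  "closed_octant b1 b2 b3 = {pt (vcomb b1 b2 b3 x) | x. x \<noteq> 0 \<and> (\<forall>i. x $ i \<ge> 0)}"

lemma pos_nonzero: "\<forall>i. (x :: real^3) $ i > 0 \<Longrightarrow> x \<noteq> 0"
  by (auto simp: vec_eq_iff forall_3)

lemma pt_mem_octant_iff:
  assumes "is_basis3 W b1 b2 b3"
  shows "pt (vcomb b1 b2 b3 x) \<in> octant b1 b2 b3 \<longleftrightarrow> (\<forall>i. x $ i > 0) \<or> (\<forall>i. x $ i < 0)"
proof
  assume "pt (vcomb b1 b2 b3 x) \<in> octant b1 b2 b3"
  then obtain y where y: "\<forall>i. y $ i > 0" "pt (vcomb b1 b2 b3 y) = pt (vcomb b1 b2 b3 x)"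
    by (auto simp: octant_def)
  then obtain c where c: "c \<noteq> 0" "x = c *\<^sub>R y"
    using pt_vcomb_eq_iff[OF assms pos_nonzero[OF y(1)]] by blast
  show "(\<forall>i. x $ i > 0) \<or> (\<forall>i. x $ i < 0)"
  proof (cases "c > 0")
    case True
    then show ?thesis using c y(1) by simp
  next
    case False
    then show ?thesis using c y(1) by (simp add: mult_neg_pos)
  qed
next
  assume "(\<forall>i. x $ i > 0) \<or> (\<forall>i. x $ i < 0)"
  then show "pt (vcomb b1 b2 b3 x) \<in> octant b1 b2 b3"
  proof
    assume "\<forall>i. x $ i < 0"
    then have "\<forall>i. (- x) $ i > 0" by simp
    moreover have "pt (vcomb b1 b2 b3 x) = pt (vcomb b1 b2 b3 (- x))"
      using vcomb_scaleR[of b1 b2 b3 "- 1" x] pt_scale[of "- 1"] by simp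
    ultimately show ?thesis by (auto simp: octant_def)
  qed (auto simp: octant_def)
qed

lemma pt_mem_closed_octant_iff:
  assumes "is_basis3 W b1 b2 b3" "x \<noteq> 0"
  shows "pt (vcomb b1 b2 b3 x) \<in> closed_octant b1 b2 b3 \<longleftrightarrow> (\<forall>i. x $ i \<ge> 0) \<or> (\<forall>i. x $ i \<le> 0)"
proof
  assume "pt (vcomb b1 b2 b3 x) \<in> closed_octant b1 b2 b3"
  then obtain y where y: "y \<noteq> 0" "\<forall>i. y $ i \<ge> 0" "pt (vcomb b1 b2 b3 y) = pt (vcomb b1 b2 b3 x)"
    by (auto simp: closed_octant_def)
  then obtain c where c: "c \<noteq> 0" "x = c *\<^sub>R y"
    using pt_vcomb_eq_iff[OF assms(1) y(1)] by blast
  show "(\<forall>i. x $ i \<ge> 0) \<or> (\<forall>i. x $ i \<le> 0)"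
  proof (cases "c > 0")
    case True
    then show ?thesis using c y(2) by simp
  next
    case False
    then show ?thesis using c y(2) by (simp add: mult_nonpos_nonneg)
  qed
next
  assume "(\<forall>i. x $ i \<ge> 0) \<or> (\<forall>i. x $ i \<le> 0)"
  then show "pt (vcomb b1 b2 b3 x) \<in> closed_octant b1 b2 b3"
  proof
    assume "\<forall>i. x $ i \<le> 0"
    then have "\<forall>i. (- x) $ i \<ge> 0" "- x \<noteq> 0" using assms(2) by simp_all
    moreover have "pt (vcomb b1 b2 b3 x) = pt (vcomb b1 b2 b3 (- x))"
      using vcomb_scaleR[of b1 b2 b3 "- 1" x] pt_scale[of "- 1"] by simp
    ultimately show ?thesis unfolding closed_octant_def by auto
  qed (use assms(2) in \<open>auto simp: closed_octant_def\<close>)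
qed

lemma octant_subset_closed_octant: "octant b1 b2 b3 \<subseteq> closed_octant b1 b2 b3"
  unfolding octant_def closed_octant_def using pos_nonzero less_imp_le by blast

lemma closed_octant_subset_Proj:
  "is_basis3 W b1 b2 b3 \<Longrightarrow> closed_octant b1 b2 b3 \<subseteq> Proj W"
  by (auto simp: closed_octant_def Proj_basis3)

lemma octant_subset_Proj:
  "is_basis3 W b1 b2 b3 \<Longrightarrow> octant b1 b2 b3 \<subseteq> Proj W"
  using octant_subset_closed_octant closed_octant_subset_Proj by blast

lemma openin_octant:
  assumes "is_basis3 W b1 b2 b3"
  shows "openin (proj_topology W) (octant b1 b2 b3)"
proof -
  have "{x. x \<noteq> 0 \<and> pt (vcomb b1 b2 b3 x) \<in> octant b1 b2 b3} =
      {x. (x $ 1 > 0 \<and> x $ 2 > 0 \<and> x $ 3 > 0) \<or> (x $ 1 < 0 \<and> x $ 2 < 0 \<and> x $ 3 < 0)}"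
    unfolding pt_mem_octant_iff[OF assms] forall_3 by auto
  also have "open \<dots>"
    by (intro open_Collect_conj open_Collect_disj open_Collect_less continuous_intros)
  finally show ?thesis
    unfolding openin_proj_topology proj_open_iff[OF assms] using octant_subset_Proj[OF assms] by simp
qed

lemma closedin_closed_octant:
  assumes "is_basis3 W b1 b2 b3"
  shows "closedin (proj_topology W) (closed_octant b1 b2 b3)"
proof -
  have "{x. x \<noteq> 0 \<and> pt (vcomb b1 b2 b3 x) \<in> Proj W - closed_octant b1 b2 b3} =
      {x. (x $ 1 < 0 \<or> x $ 2 < 0 \<or> x $ 3 < 0) \<and> (x $ 1 > 0 \<or> x $ 2 > 0 \<or> x $ 3 > 0)}"
  proof (intro set_eqI iffI)
    fix x assume "x \<in> {x. x \<noteq> 0 \<and> pt (vcomb b1 b2 b3 x) \<in> Proj W - closed_octant b1 b2 b3}"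
    then show "x \<in> {x. (x $ 1 < 0 \<or> x $ 2 < 0 \<or> x $ 3 < 0) \<and> (x $ 1 > 0 \<or> x $ 2 > 0 \<or> x $ 3 > 0)}"
      using pt_mem_closed_octant_iff[OF assms, of x] by (auto simp: forall_3 not_le)
  next
    fix x :: "real^3"
    assume x: "x \<in> {x. (x $ 1 < 0 \<or> x $ 2 < 0 \<or> x $ 3 < 0) \<and> (x $ 1 > 0 \<or> x $ 2 > 0 \<or> x $ 3 > 0)}"
    then have nz: "x \<noteq> 0" by auto
    then have "pt (vcomb b1 b2 b3 x) \<in> Proj W" using Proj_basis3[OF assms] by blast
    then show "x \<in> {x. x \<noteq> 0 \<and> pt (vcomb b1 b2 b3 x) \<in> Proj W - closed_octant b1 b2 b3}"
      using pt_mem_closed_octant_iff[OF assms nz] x nz by (auto simp: forall_3)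
  qed
  also have "open \<dots>"
    by (intro open_Collect_conj open_Collect_disj open_Collect_less continuous_intros)
  finally show ?thesis
    unfolding closedin_def openin_proj_topology proj_open_iff[OF assms] topspace_proj_topology[OF assms]
    using closed_octant_subset_Proj[OF assms] by simp
qed

text \<open>Adding a small multiple of \<open>(1, 1, 1)\<close> moves a nonzero nonnegative vector into the positive orthant, so
  every point of the closed octant is a limit of points of the octant.\<close>

lemma closure_of_octant:
  assumes "is_basis3 W b1 b2 b3"
  shows "proj_topology W closure_of octant b1 b2 b3 = closed_octant b1 b2 b3"
proof
  show "proj_topology W closure_of octant b1 b2 b3 \<subseteq> closed_octant b1 b2 b3"
    using octant_subset_closed_octant closedin_closed_octant[OF assms] by (rule closure_of_minimal)
  show "closed_octant b1 b2 b3 \<subseteq> proj_topology W closure_of octant b1 b2 b3"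
  proof
    fix q assume "q \<in> closed_octant b1 b2 b3"
    then obtain x where x: "x \<noteq> 0" "\<forall>i. x $ i \<ge> 0" and q: "q = pt (vcomb b1 b2 b3 x)"
      by (auto simp: closed_octant_def)
    show "q \<in> proj_topology W closure_of octant b1 b2 b3"
      unfolding in_closure_of
    proof (intro conjI allI impI)
      show "q \<in> topspace (proj_topology W)"
        using x(1) by (auto simp: q topspace_proj_topology[OF assms] Proj_basis3[OF assms])
      fix T assume "q \<in> T \<and> openin (proj_topology W) T"
      then have "x \<in> {x. x \<noteq> 0 \<and> pt (vcomb b1 b2 b3 x) \<in> T}" "open {x. x \<noteq> 0 \<and> pt (vcomb b1 b2 b3 x) \<in> T}"
        using x(1) by (simp_all add: q openin_proj_topology proj_open_iff[OF assms])
      then obtain e where e: "e > 0" "ball x e \<subseteq> {x. x \<noteq> 0 \<and> pt (vcomb b1 b2 b3 x) \<in> T}"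
        unfolding open_contains_ball by blast
      define u :: "real^3" where "u = 1"
      define y where "y = x + (e / (2 * norm u)) *\<^sub>R u"
      have u: "norm u > 0" by (simp add: u_def vec_eq_iff)
      then have "dist x y < e" using e(1) by (simp add: y_def dist_norm)
      then have "pt (vcomb b1 b2 b3 y) \<in> T" using e(2) by auto
      moreover have "y $ i > 0" for i
      proof -
        have "e / (2 * norm u) > 0" using e(1) u by simp
        then show ?thesis using x(2) by (simp add: y_def u_def add_nonneg_pos)
      qed
      then have "pt (vcomb b1 b2 b3 y) \<in> octant b1 b2 b3" by (auto simp: octant_def)
      ultimately show "\<exists>y. y \<in> octant b1 b2 b3 \<and> y \<in> T" by blast
    qed
  qed
qed

text \<open>The trace of the octant on a line is the image of a convex cone under the continuous quotient map.\<close>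

lemma proj_convex_octant:
  assumes "is_basis3 W b1 b2 b3"
  shows "proj_convex W (octant b1 b2 b3)"
  unfolding proj_convex_def
proof (intro conjI allI impI)
  show "octant b1 b2 b3 \<subseteq> Proj W" by (rule octant_subset_Proj[OF assms])
  fix L assume "proj_line W L"
  then obtain S where S: "subspace S" "L = Proj S" by (auto simp: proj_line_def)
  define K where "K = {x. (\<forall>i. x $ i > 0) \<and> vcomb b1 b2 b3 x \<in> S}"
  have "convex {x. vcomb b1 b2 b3 x \<in> S}"
    using S(1) by (intro convexI) (simp add: vcomb_add vcomb_scaleR subspace_add subspace_scale)
  then have "convex K"
    unfolding K_def Collect_conj_eq by (rule convex_Int[OF convex_positive_orthant])
  moreover have "octant b1 b2 b3 \<inter> L = (\<lambda>x. pt (vcomb b1 b2 b3 x)) ` K"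
  proof -
    have "pt (vcomb b1 b2 b3 x) \<in> L \<longleftrightarrow> vcomb b1 b2 b3 x \<in> S" if "\<forall>i. x $ i > 0" for x
      unfolding S(2) using S(1) vcomb_eq_0_iff[OF assms] pos_nonzero[OF that] by (intro pt_mem_Proj_iff) auto
    then show ?thesis unfolding octant_def K_def by auto
  qed
  moreover have "0 \<notin> K" by (auto simp: K_def)
  ultimately show "connectedin (proj_topology W) (octant b1 b2 b3 \<inter> L)"
    using connectedin_pt_vcomb_image[OF assms] convex_connected by metis
qed

lemma unit_point_vcomb: "pt (b1 + b2 + b3) = pt (vcomb b1 b2 b3 1)"
  by (simp add: vcomb_def comb3_def)

lemma avoiding_unit_line:
  assumes "is_basis3 W b1 b2 b3"
  shows "avoiding_line W (octant b1 b2 b3) (Proj (zero_sum_plane b1 b2 b3))"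
proof -
  have "proj_line W (Proj (zero_sum_plane b1 b2 b3))"
    unfolding zero_sum_plane_span by (rule proj_line_basis[OF zero_sum_basis[OF assms]])
  moreover have "q \<notin> Proj (zero_sum_plane b1 b2 b3)" if q_mem: "q \<in> closed_octant b1 b2 b3" for q
  proof -
    obtain x where x: "x \<noteq> 0" "\<forall>i. x $ i \<ge> 0" and q: "q = pt (vcomb b1 b2 b3 x)"
      using q_mem by (auto simp: closed_octant_def)
    have "q \<in> Proj (zero_sum_plane b1 b2 b3) \<longleftrightarrow> vcomb b1 b2 b3 x \<in> zero_sum_plane b1 b2 b3"
      unfolding q using x(1) vcomb_eq_0_iff[OF assms]
      by (intro pt_mem_Proj_iff subspace_zero_sum_plane) auto
    also have "\<dots> \<longleftrightarrow> x $ 1 + x $ 2 + x $ 3 = 0"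
      unfolding vcomb_def by (rule comb3_mem_zero_sum_plane[OF assms])
    also have "\<not> \<dots>"
      using x by (auto simp: vec_eq_iff forall_3 add_nonneg_eq_0_iff)
    finally show ?thesis .
  qed
  ultimately show ?thesis
    unfolding avoiding_line_def closure_of_octant[OF assms] by blast
qed

lemma proper_open_convex_octant:
  assumes "is_basis3 W b1 b2 b3"
  shows "proper_open_convex W (octant b1 b2 b3)"
  unfolding proper_open_convex_def
  using openin_octant[OF assms] proj_convex_octant[OF assms] avoiding_unit_line[OF assms]
    pt_mem_octant_iff[OF assms, of 1] by fastforce

end

section \<open>The convex polar\<close>

context real_proj_space
begin

text \<open>Every chart sending the zero-sum line to infinity has, after rescaling by a constant \<open>k\<close>, affine
  coordinates of total sum 1. In these the octant is the triangle of \<open>center_of_gravity_triangle\<close>; a point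
  cannot have three negative coordinates, so the ambiguity of sign disappears.\<close>

lemma barycenter_octant_in_chart:
  assumes "is_basis3 W b1 b2 b3" "affine_parametrization W (Proj (zero_sum_plane b1 b2 b3)) \<phi>"
  shows "\<phi> (center_of_gravity (\<phi> -` octant b1 b2 b3)) = pt (b1 + b2 + b3)"
proof -
  obtain e1 e2 e3 where e: "is_basis3 W e1 e2 e3" and D: "Proj (zero_sum_plane b1 b2 b3) = Proj (span {e1, e2})"
    and \<phi>: "\<phi> = (\<lambda>x. pt (scale (x $ 1) e1 + scale (x $ 2) e2 + e3))"
    using assms(2) by (auto simp: affine_parametrization_def)
  have pl: "zero_sum_plane b1 b2 b3 = span {e1, e2}"
    using D Proj_eq_iff subspace_zero_sum_plane by simp
  have "e1 \<in> W" "e2 \<in> W" "e3 \<in> W"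
    using e by (auto simp: is_basis3_def intro: span_base)
  then obtain a b c where abc: "e1 = vcomb b1 b2 b3 a" "e2 = vcomb b1 b2 b3 b" "e3 = vcomb b1 b2 b3 c"
    using vcomb_obtain[OF assms(1)] by metis
  have plane_iff: "vcomb b1 b2 b3 x \<in> span {e1, e2} \<longleftrightarrow> x $ 1 + x $ 2 + x $ 3 = 0" for x
    unfolding vcomb_def pl[symmetric] by (rule comb3_mem_zero_sum_plane[OF assms(1)])
  define s where "s = c $ 1 + c $ 2 + c $ 3"
  have sums: "a $ 1 + a $ 2 + a $ 3 = 0" "b $ 1 + b $ 2 + b $ 3 = 0"
    unfolding plane_iff[symmetric] abc[symmetric] by (simp_all add: span_base)
  have s: "s \<noteq> 0"
  proof
    assume "s = 0"
    then have "e3 \<in> span {e1, e2}" unfolding abc(3) plane_iff s_def .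
    then obtain x y where "e3 = scale x e1 + scale y e2" by (auto simp: span2)
    then have "comb3 e1 e2 e3 x y (- 1) = 0" by (simp add: comb3_def)
    then show False using basis3_comb3_eq_0_iff[OF e] by simp
  qed
  \<comment> \<open>The class of a vector does not change under scaling, so the sum of its coordinates can be made 1.\<close>
  define k where "k = inverse s"
  define aff where "aff x = (x $ 1) *\<^sub>R (k *\<^sub>R a) + (x $ 2) *\<^sub>R (k *\<^sub>R b) + k *\<^sub>R c" for x :: "real^2"
  have k: "k \<noteq> 0" "k * s = 1" using s by (simp_all add: k_def)
  have \<phi>_aff: "\<phi> x = pt (vcomb b1 b2 b3 (aff x))" for x
  proof -
    have "vcomb b1 b2 b3 (aff x) = scale k (scale (x $ 1) e1 + scale (x $ 2) e2 + e3)"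
      unfolding abc vcomb_scaleR[symmetric] vcomb_add[symmetric] by (simp add: aff_def algebra_simps)
    then show ?thesis using k(1) by (simp add: \<phi> pt_scale)
  qed
  have ksums: "(k *\<^sub>R a) $ 1 + (k *\<^sub>R a) $ 2 + (k *\<^sub>R a) $ 3 = 0" "(k *\<^sub>R b) $ 1 + (k *\<^sub>R b) $ 2 + (k *\<^sub>R b) $ 3 = 0"
    "(k *\<^sub>R c) $ 1 + (k *\<^sub>R c) $ 2 + (k *\<^sub>R c) $ 3 = 1"
    using sums k(2) by (simp_all add: s_def distrib_left[symmetric])
  have aff_sum: "aff x $ 1 + aff x $ 2 + aff x $ 3 = 1" for x
  proof -
    have "aff x $ 1 + aff x $ 2 + aff x $ 3 =
      x $ 1 * ((k *\<^sub>R a) $ 1 + (k *\<^sub>R a) $ 2 + (k *\<^sub>R a) $ 3)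
      + x $ 2 * ((k *\<^sub>R b) $ 1 + (k *\<^sub>R b) $ 2 + (k *\<^sub>R b) $ 3)
      + ((k *\<^sub>R c) $ 1 + (k *\<^sub>R c) $ 2 + (k *\<^sub>R c) $ 3)"
      by (simp add: aff_def algebra_simps)
    then show ?thesis unfolding ksums by simp
  qed
  have inj: "x = 0 \<and> y = 0" if "x *\<^sub>R (k *\<^sub>R a) + y *\<^sub>R (k *\<^sub>R b) = 0" for x y
  proof -
    have "vcomb b1 b2 b3 ((x * k) *\<^sub>R a + (y * k) *\<^sub>R b) = 0"
      using that by (simp add: vcomb_eq_0_iff[OF assms(1)])
    then have "comb3 e1 e2 e3 (x * k) (y * k) 0 = 0"
      by (simp add: comb3_def abc vcomb_add vcomb_scaleR)
    then show ?thesis using basis3_comb3_eq_0_iff[OF e] k(1) by simp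
  qed
  have "\<phi> -` octant b1 b2 b3 = {x. aff x $ 1 > 0 \<and> aff x $ 2 > 0 \<and> aff x $ 3 > 0}"
  proof -
    have "\<phi> x \<in> octant b1 b2 b3 \<longleftrightarrow> aff x $ 1 > 0 \<and> aff x $ 2 > 0 \<and> aff x $ 3 > 0" for x
      using aff_sum[of x] unfolding \<phi>_aff pt_mem_octant_iff[OF assms(1)] forall_3 by linarith
    then show ?thesis by (simp add: vimage_def)
  qed
  then have "aff (center_of_gravity (\<phi> -` octant b1 b2 b3)) $ i = 1 / 3" for i
    unfolding aff_def using center_of_gravity_triangle[OF ksums inj, of i] by simp
  then have "aff (center_of_gravity (\<phi> -` octant b1 b2 b3)) = (1 / 3) *\<^sub>R 1"
    by (simp add: vec_eq_iff)
  then show ?thesis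
    unfolding \<phi>_aff by (simp add: vcomb_scaleR pt_scale unit_point_vcomb)
qed

lemma line_barycenter_octant:
  assumes "is_basis3 W b1 b2 b3"
  shows "line_barycenter W (octant b1 b2 b3) (Proj (zero_sum_plane b1 b2 b3)) = pt (b1 + b2 + b3)"
  unfolding line_barycenter_def
proof (rule the_equality)
  let ?\<phi> = "\<lambda>x :: real^2. pt (scale (x $ 1) (b1 - b3) + scale (x $ 2) (b2 - b3) + b3)"
  have \<phi>: "affine_parametrization W (Proj (zero_sum_plane b1 b2 b3)) ?\<phi>"
    unfolding affine_parametrization_def zero_sum_plane_span using zero_sum_basis[OF assms] by blast
  show "proper_open_convex W (octant b1 b2 b3) \<and>
    avoiding_line W (octant b1 b2 b3) (Proj (zero_sum_plane b1 b2 b3)) \<and>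
    (\<exists>\<phi>. affine_parametrization W (Proj (zero_sum_plane b1 b2 b3)) \<phi> \<and>
       pt (b1 + b2 + b3) = \<phi> (center_of_gravity (\<phi> -` octant b1 b2 b3)))"
    by (intro conjI exI[of _ ?\<phi>] proper_open_convex_octant[OF assms] avoiding_unit_line[OF assms] \<phi>
        barycenter_octant_in_chart[OF assms \<phi>, symmetric])
next
  fix q assume "proper_open_convex W (octant b1 b2 b3) \<and>
    avoiding_line W (octant b1 b2 b3) (Proj (zero_sum_plane b1 b2 b3)) \<and>
    (\<exists>\<phi>. affine_parametrization W (Proj (zero_sum_plane b1 b2 b3)) \<phi> \<and>
       q = \<phi> (center_of_gravity (\<phi> -` octant b1 b2 b3)))"
  then obtain \<phi> where \<phi>: "affine_parametrization W (Proj (zero_sum_plane b1 b2 b3)) \<phi>"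
    and q: "q = \<phi> (center_of_gravity (\<phi> -` octant b1 b2 b3))" by blast
  show "q = pt (b1 + b2 + b3)" unfolding q by (rule barycenter_octant_in_chart[OF assms \<phi>])
qed

lemma pt_vcomb_mem_side_iff:
  assumes "is_basis3 UNIV b1 b2 b3" "x \<noteq> 0"
  shows "pt (vcomb b1 b2 b3 x) \<in> proj_join (pt b2) (pt b3) \<longleftrightarrow> x $ 1 = 0"
    "pt (vcomb b1 b2 b3 x) \<in> proj_join (pt b1) (pt b3) \<longleftrightarrow> x $ 2 = 0"
    "pt (vcomb b1 b2 b3 x) \<in> proj_join (pt b1) (pt b2) \<longleftrightarrow> x $ 3 = 0"
proof -
  have nz: "vcomb b1 b2 b3 x \<noteq> 0" using assms vcomb_eq_0_iff by blast
  have side: "pt (vcomb b1 b2 b3 x) \<in> proj_join (pt a) (pt b) \<longleftrightarrow> (\<exists>s t. vcomb b1 b2 b3 x = scale s a + scale t b)" for a b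
    unfolding proj_join_pt using pt_mem_Proj_iff[OF subspace_span nz] by (simp add: span2)
  have "(\<exists>s t. vcomb b1 b2 b3 x = scale s b2 + scale t b3) \<longleftrightarrow>
      (\<exists>s t. comb3 b1 b2 b3 (x $ 1) (x $ 2) (x $ 3) = comb3 b1 b2 b3 0 s t)"
    by (simp add: vcomb_def comb3_def)
  then show "pt (vcomb b1 b2 b3 x) \<in> proj_join (pt b2) (pt b3) \<longleftrightarrow> x $ 1 = 0"
    unfolding side basis3_comb3_eq_iff[OF assms(1)] by blast
  have "(\<exists>s t. vcomb b1 b2 b3 x = scale s b1 + scale t b3) \<longleftrightarrow>
      (\<exists>s t. comb3 b1 b2 b3 (x $ 1) (x $ 2) (x $ 3) = comb3 b1 b2 b3 s 0 t)"
    by (simp add: vcomb_def comb3_def)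
  then show "pt (vcomb b1 b2 b3 x) \<in> proj_join (pt b1) (pt b3) \<longleftrightarrow> x $ 2 = 0"
    unfolding side basis3_comb3_eq_iff[OF assms(1)] by blast
  have "(\<exists>s t. vcomb b1 b2 b3 x = scale s b1 + scale t b2) \<longleftrightarrow>
      (\<exists>s t. comb3 b1 b2 b3 (x $ 1) (x $ 2) (x $ 3) = comb3 b1 b2 b3 s t 0)"
    by (simp add: vcomb_def comb3_def)
  then show "pt (vcomb b1 b2 b3 x) \<in> proj_join (pt b1) (pt b2) \<longleftrightarrow> x $ 3 = 0"
    unfolding side basis3_comb3_eq_iff[OF assms(1)] by blast
qed

text \<open>The octant is connected as an image of the positive orthant, and it is both open and closed in the
  complement of the sides: the rest of the complement consists of the vectors whose coordinates are
  nonzero and of mixed sign, which is an open condition.\<close>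

lemma octant_is_component:
  assumes "is_basis3 UNIV b1 b2 b3"
  defines "Y \<equiv> Proj UNIV - (proj_join (pt b2) (pt b3) \<union> proj_join (pt b1) (pt b3) \<union> proj_join (pt b1) (pt b2))"
  shows "connected_component_of_set (subtopology (proj_topology UNIV) Y) (pt (b1 + b2 + b3)) = octant b1 b2 b3"
proof -
  let ?X = "subtopology (proj_topology UNIV) Y"
  note mem_side = pt_vcomb_mem_side_iff[OF assms(1)]
  have Y: "pt (vcomb b1 b2 b3 x) \<in> Y \<longleftrightarrow> x $ 1 \<noteq> 0 \<and> x $ 2 \<noteq> 0 \<and> x $ 3 \<noteq> 0" if "x \<noteq> 0" for x
    using mem_side[OF that] Proj_basis3[OF assms(1)] that unfolding Y_def by blast
  have YP: "Y \<subseteq> Proj UNIV" by (auto simp: Y_def)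
  have sub: "octant b1 b2 b3 \<subseteq> Y"
  proof
    fix q assume "q \<in> octant b1 b2 b3"
    then obtain x where x: "q = pt (vcomb b1 b2 b3 x)" "\<forall>i. x $ i > 0" by (auto simp: octant_def)
    have "x $ 1 > 0" "x $ 2 > 0" "x $ 3 > 0" using x(2) by blast+
    then show "q \<in> Y" unfolding x(1) Y[OF pos_nonzero[OF x(2)]] by linarith
  qed
  have top: "topspace ?X = Y"
    using YP by (simp add: topspace_proj_topology[OF assms(1)] Int_absorb1)
  have op: "openin ?X (octant b1 b2 b3)"
    using openin_octant[OF assms(1)] sub by (simp add: openin_subtopology_alt image_iff) (metis Int_absorb1)
  have "openin (proj_topology UNIV) (Y - octant b1 b2 b3)"
  proof -
    have "{x. x \<noteq> 0 \<and> pt (vcomb b1 b2 b3 x) \<in> Y - octant b1 b2 b3} =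
      {x. ((x $ 1 < 0 \<or> x $ 1 > 0) \<and> (x $ 2 < 0 \<or> x $ 2 > 0) \<and> (x $ 3 < 0 \<or> x $ 3 > 0)) \<and>
          (x $ 1 < 0 \<or> x $ 2 < 0 \<or> x $ 3 < 0) \<and> (x $ 1 > 0 \<or> x $ 2 > 0 \<or> x $ 3 > 0)}"
    proof (intro set_eqI)
      fix x :: "real^3"
      show "x \<in> {x. x \<noteq> 0 \<and> pt (vcomb b1 b2 b3 x) \<in> Y - octant b1 b2 b3} \<longleftrightarrow>
        x \<in> {x. ((x $ 1 < 0 \<or> x $ 1 > 0) \<and> (x $ 2 < 0 \<or> x $ 2 > 0) \<and> (x $ 3 < 0 \<or> x $ 3 > 0)) \<and>
          (x $ 1 < 0 \<or> x $ 2 < 0 \<or> x $ 3 < 0) \<and> (x $ 1 > 0 \<or> x $ 2 > 0 \<or> x $ 3 > 0)}"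
      proof (cases "x = 0")
        case False
        then show ?thesis
          unfolding mem_Collect_eq Diff_iff Y[OF False] pt_mem_octant_iff[OF assms(1)] forall_3
          by linarith
      qed simp
    qed
    also have "open \<dots>"
      by (intro open_Collect_conj open_Collect_disj open_Collect_less continuous_intros)
    finally show ?thesis
      unfolding openin_proj_topology proj_open_iff[OF assms(1)] using YP by blast
  qed
  then have "openin ?X (Y - octant b1 b2 b3)"
    by (simp add: openin_subtopology_alt image_iff) (metis Diff_subset Int_absorb1)
  then have cl: "closedin ?X (octant b1 b2 b3)"
    unfolding closedin_def top using sub by blast
  have conn: "connectedin ?X (octant b1 b2 b3)"
  proof -
    have "connectedin (proj_topology UNIV) ((\<lambda>x. pt (vcomb b1 b2 b3 x)) ` {x. \<forall>i. x $ i > 0})"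
      by (intro connectedin_pt_vcomb_image[OF assms(1)] convex_connected convex_positive_orthant) auto
    also have "(\<lambda>x. pt (vcomb b1 b2 b3 x)) ` {x. \<forall>i. x $ i > 0} = octant b1 b2 b3"
      by (auto simp: octant_def)
    finally show ?thesis using sub by (simp add: connectedin_subtopology)
  qed
  have p: "pt (b1 + b2 + b3) \<in> octant b1 b2 b3"
    unfolding unit_point_vcomb pt_mem_octant_iff[OF assms(1)] by simp
  let ?C = "connected_component_of_set ?X (pt (b1 + b2 + b3))"
  have pC: "pt (b1 + b2 + b3) \<in> ?C"
    using p sub top by (simp add: connected_component_of_refl) blast
  show ?thesis
  proof
    show "octant b1 b2 b3 \<subseteq> ?C" by (rule connected_component_of_maximal[OF conn p])
    have "?C \<subseteq> octant b1 b2 b3 \<or> disjnt ?C (octant b1 b2 b3)"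
      by (rule connectedin_clopen_cases[OF connectedin_connected_component_of cl op])
    then show "?C \<subseteq> octant b1 b2 b3" using p pC by (auto simp: disjnt_def)
  qed
qed

text \<open>A form that vanishes nowhere on the closed octant is nonzero on the basis vectors, and its values on
  them have the same sign: were they of opposite signs on \<open>b1\<close> and \<open>b2\<close>, say, it would vanish at the
  nonnegative combination with coefficients \<open>\<bar>f b2\<bar>\<close> and \<open>\<bar>f b1\<bar>\<close>.\<close>

lemma avoiding_octant_iff:
  assumes "is_basis3 UNIV b1 b2 b3"
  shows "avoiding_line UNIV (octant b1 b2 b3) L \<longleftrightarrow>
    (\<exists>f. linear_form f \<and> f b1 > 0 \<and> f b2 > 0 \<and> f b3 > 0 \<and> L = kernel_line f)"
proof
  have mem: "pt (vcomb b1 b2 b3 x) \<in> kernel_line f \<longleftrightarrow> x $ 1 * f b1 + x $ 2 * f b2 + x $ 3 * f b3 = 0"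
    if "linear_form f" "x \<noteq> 0" for f x
    using pt_mem_Proj_iff[OF subspace_kernel_form[OF that(1)], of "vcomb b1 b2 b3 x"]
      vcomb_eq_0_iff[OF assms] that linear_form_comb3[OF that(1)]
    by (simp add: kernel_line_def vcomb_def)
  {
    assume L: "avoiding_line UNIV (octant b1 b2 b3) L"
    then obtain f where f: "linear_form f" "f \<noteq> 0" "L = kernel_line f"
      using proj_line_obtain_form[OF assms] by (auto simp: avoiding_line_def)
    have nz: "x $ 1 * f b1 + x $ 2 * f b2 + x $ 3 * f b3 \<noteq> 0"
      if x: "x \<noteq> 0" "x $ 1 \<ge> 0" "x $ 2 \<ge> 0" "x $ 3 \<ge> 0" for x :: "real^3"
    proof -
      have "pt (vcomb b1 b2 b3 x) \<in> closed_octant b1 b2 b3"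
        using x unfolding closed_octant_def forall_3 by blast
      then have "pt (vcomb b1 b2 b3 x) \<notin> kernel_line f"
        using L unfolding avoiding_line_def closure_of_octant[OF assms] f(3) by blast
      then show ?thesis using mem[OF f(1) x(1)] by simp
    qed
    have nz': "r * f b1 + s * f b2 + t * f b3 \<noteq> 0"
      if "r \<ge> 0" "s \<ge> 0" "t \<ge> 0" "r \<noteq> 0 \<or> s \<noteq> 0 \<or> t \<noteq> 0" for r s t :: real
      using nz[of "vector [r, s, t]"] that by (simp add: vec_eq_iff forall_3)
    have ne: "f b1 \<noteq> 0" "f b2 \<noteq> 0" "f b3 \<noteq> 0"
      using nz'[of 1 0 0] nz'[of 0 1 0] nz'[of 0 0 1] by auto
    have same: "\<not> (f b1 < 0 \<and> f b2 > 0)" "\<not> (f b1 > 0 \<and> f b2 < 0)"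
        "\<not> (f b1 < 0 \<and> f b3 > 0)" "\<not> (f b1 > 0 \<and> f b3 < 0)"
      using nz'[of "\<bar>f b2\<bar>" "\<bar>f b1\<bar>" 0] nz'[of "\<bar>f b3\<bar>" 0 "\<bar>f b1\<bar>"] by (auto simp: mult.commute)
    show "\<exists>f. linear_form f \<and> f b1 > 0 \<and> f b2 > 0 \<and> f b3 > 0 \<and> L = kernel_line f"
    proof (cases "f b1 > 0")
      case True
      then have "f b2 > 0" "f b3 > 0" using same ne by linarith+
      then show ?thesis using True f by blast
    next
      case False
      then have "f b1 < 0" "f b2 < 0" "f b3 < 0" using same ne by linarith+
      then show ?thesis
        using f linear_form_scale[OF f(1), of "- 1"] kernel_line_dual_scale[of "- 1" f]
        by (intro exI[of _ "dual_scale (- 1) f"]) (simp add: dual_scale_def)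
    qed
  next
    assume "\<exists>f. linear_form f \<and> f b1 > 0 \<and> f b2 > 0 \<and> f b3 > 0 \<and> L = kernel_line f"
    then obtain f where f: "linear_form f" "f b1 > 0" "f b2 > 0" "f b3 > 0" "L = kernel_line f" by blast
    have "proj_line UNIV L"
      unfolding f(5) using f(2) by (intro proj_line_kernel_line[OF assms f(1)]) simp
    moreover have "q \<notin> L" if q_mem: "q \<in> closed_octant b1 b2 b3" for q
    proof -
      obtain x where x: "x \<noteq> 0" "\<forall>i. x $ i \<ge> 0" and q: "q = pt (vcomb b1 b2 b3 x)"
        using q_mem by (auto simp: closed_octant_def)
      have "x $ 1 * f b1 \<ge> 0" "x $ 2 * f b2 \<ge> 0" "x $ 3 * f b3 \<ge> 0"
        using x(2) f(2-4) by (simp_all add: less_imp_le)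
      moreover have "x $ 1 * f b1 \<noteq> 0 \<or> x $ 2 * f b2 \<noteq> 0 \<or> x $ 3 * f b3 \<noteq> 0"
        using x(1) f(2-4) by (auto simp: vec_eq_iff forall_3)
      ultimately have "x $ 1 * f b1 + x $ 2 * f b2 + x $ 3 * f b3 \<noteq> 0" by linarith
      then show ?thesis using mem[OF f(1) x(1)] by (simp add: q f(5))
    qed
    ultimately show "avoiding_line UNIV (octant b1 b2 b3) L"
      unfolding avoiding_line_def closure_of_octant[OF assms] by blast
  }
qed

lemma dual_convex_octant:
  assumes "is_basis3 UNIV b1 b2 b3" "dual_basis3 b1 b2 b3 f1 f2 f3"
  shows "dual_convex (octant b1 b2 b3) = real_dual.octant f1 f2 f3"
proof (intro set_eqI iffI)
  fix q assume "q \<in> dual_convex (octant b1 b2 b3)"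
  then obtain f where f: "linear_form f" "f b1 > 0" "f b2 > 0" "f b3 > 0" "q = line_dual (kernel_line f)"
    unfolding dual_convex_def avoiding_octant_iff[OF assms(1)] by blast
  have "f \<noteq> 0" using f(2) by auto
  then have "q = dual.pt f" using f line_dual_kernel_line by simp
  also have "f = real_dual.vcomb f1 f2 f3 (vector [f b1, f b2, f b3])"
    using linear_form_dual_expansion[OF assms f(1)] by (simp add: real_dual.comb3_eq_vcomb)
  finally show "q \<in> real_dual.octant f1 f2 f3"
    unfolding real_dual.octant_def using f(2-4) by (auto simp: forall_3)
next
  fix q assume "q \<in> real_dual.octant f1 f2 f3"
  then obtain x where x: "q = dual.pt (real_dual.vcomb f1 f2 f3 x)" "\<forall>i. x $ i > 0"
    by (auto simp: real_dual.octant_def)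
  define f where "f = dual.comb3 f1 f2 f3 (x $ 1) (x $ 2) (x $ 3)"
  have q: "q = dual.pt f" by (simp add: x(1) f_def real_dual.vcomb_def)
  have lin: "linear_form f"
    using assms(2) unfolding f_def by (simp add: dual_basis3_def linear_form_dual_comb3)
  have "f b1 = x $ 1" "f b2 = x $ 2" "f b3 = x $ 3"
    using assms(2) by (simp_all add: f_def dual.comb3_def dual_basis3_def dual_scale_def)
  then have pos: "f b1 > 0" "f b2 > 0" "f b3 > 0" using x(2) by simp_all
  then have "f \<noteq> 0" by auto
  then have "q = line_dual (kernel_line f)" using q line_dual_kernel_line[OF lin] by simp
  then show "q \<in> dual_convex (octant b1 b2 b3)"
    unfolding dual_convex_def avoiding_octant_iff[OF assms(1)] using lin pos by blast
qed

lemma convex_polar_eq: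
  assumes "is_basis3 UNIV b1 b2 b3"
  shows "convex_polar (pt b1) (pt b2) (pt b3) (pt (b1 + b2 + b3)) = Proj (zero_sum_plane b1 b2 b3)"
proof -
  obtain f1 f2 f3 where f: "dual_basis3 b1 b2 b3 f1 f2 f3"
    using dual_basis3_exists[OF assms] by blast
  show ?thesis
    unfolding convex_polar_def octant_is_component[OF assms] convex_polar_wrt_def
      dual_convex_octant[OF assms f] point_dual_unit_point[OF assms f]
      real_dual.line_barycenter_octant[OF dual_basis3_is_basis3[OF assms f]]
      dual_point_dual_pt
    by (rule kernel_line_sum_dual_basis[OF assms f])
qed

end

section \<open>Equality of the polars\<close>

theorem mainTheorem1:
  fixes scale :: "'k::field \<Rightarrow> 'v::ab_group_add \<Rightarrow> 'v"
    and rscale :: "real \<Rightarrow> 'w::ab_group_add \<Rightarrow> 'w"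
  shows
    "(vector_space scale \<and> vector_space.dim scale UNIV = 3 \<longrightarrow>
       (\<forall>p1 p2 p3 p.
          proj_space.triangle scale p1 p2 p3 \<and> proj_space.generic scale p1 p2 p3 p \<longrightarrow>
          proj_space.frame_polar scale p1 p2 p3 p = proj_space.harmonic_polar scale p1 p2 p3 p \<and>
          (CHAR('k) \<noteq> 2 \<and> CHAR('k) \<noteq> 3 \<longrightarrow>
             proj_space.cubic_polar scale p1 p2 p3 p = proj_space.frame_polar scale p1 p2 p3 p))) \<and>
     (vector_space rscale \<and> vector_space.dim rscale UNIV = 3 \<longrightarrow>
       (\<forall>p1 p2 p3 p.
          proj_space.triangle rscale p1 p2 p3 \<and> proj_space.generic rscale p1 p2 p3 p \<longrightarrow>
          real_proj_space.convex_polar rscale p1 p2 p3 p = proj_space.frame_polar rscale p1 p2 p3 p))"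
proof (intro conjI impI allI; elim conjE)
  fix p1 p2 p3 p :: "'v set"
  assume vs: "vector_space scale" and dim: "vector_space.dim scale UNIV = 3"
    and tri: "proj_space.triangle scale p1 p2 p3" and gen: "proj_space.generic scale p1 p2 p3 p"
  interpret proj_space scale using vs by (simp add: proj_space_def)
  obtain b1 b2 b3 where b: "is_basis3 UNIV b1 b2 b3"
    "p1 = pt b1" "p2 = pt b2" "p3 = pt b3" "p = pt (b1 + b2 + b3)"
    using frame_exists[OF dim tri gen] by blast
  show "frame_polar p1 p2 p3 p = harmonic_polar p1 p2 p3 p"
    unfolding b(2-5) frame_polar_eq[OF b(1)] harmonic_polar_eq[OF b(1)] ..
  assume "CHAR('k) \<noteq> 2" "CHAR('k) \<noteq> 3"
  then show "cubic_polar p1 p2 p3 p = frame_polar p1 p2 p3 p"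
    unfolding b(2-5) frame_polar_eq[OF b(1)] by (intro cubic_polar_eq[OF b(1)] six_neq_0)
next
  fix p1 p2 p3 p :: "'w set"
  assume vs: "vector_space rscale" and dim: "vector_space.dim rscale UNIV = 3"
    and tri: "proj_space.triangle rscale p1 p2 p3" and gen: "proj_space.generic rscale p1 p2 p3 p"
  interpret real_proj_space rscale using vs by (simp add: real_proj_space_def proj_space_def)
  obtain b1 b2 b3 where b: "is_basis3 UNIV b1 b2 b3"
    "p1 = pt b1" "p2 = pt b2" "p3 = pt b3" "p = pt (b1 + b2 + b3)"
    using frame_exists[OF dim tri gen] by blast
  show "convex_polar p1 p2 p3 p = frame_polar p1 p2 p3 p"
    unfolding b(2-5) frame_polar_eq[OF b(1)] by (rule convex_polar_eq[OF b(1)])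
qed

end
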